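(* Let $\alpha>0$ and let $U$ be a domain in the two-dimensional extended hyperbolic space $\mathbb{K}^2$ which is $C^{0,\frac12+\alpha}$-transversal to $\partial\mathbb{H}^2$. Then the area of $U$ is finite, i.e. the limit $\mu(U)=\lim_{\epsilon\to0^+}\int_U dV_\epsilon$ exists and is finite.
   Context: $\mathbb{K}^2=\{1\}\times\mathbb{R}^2\cong\mathbb{R}^2$ is the affine (Kleinian) model of the two-dimensional extended hyperbolic space: $\mathbb{H}^2$ is the open unit disk, the Lorentzian part $\mathbb{L}^2$ is the exterior of the closed unit disk, and $\partial\mathbb{H}^2$ is the unit circle. For $\epsilon>0$ put $d_\epsilon=1-\epsilon i$ and $$dV_\epsilon=\frac{d_\epsilon\,dx_1\,dx_2}{(d_\epsilon^2-|x|^2)^{3/2}},$$ a complex-valued density on $\mathbb{K}^2$. The branch of the power is the one continuous for $\epsilon\ge0$ off $\partial\mathbb{H}^2$ for which the limit density $dV_K=dx_1dx_2/(1-|x|^2)^{3/2}$ at $\epsilon=0$ is positive on $\mathbb{H}^2$ and equals $i^{3}$ times a positive density on $\mathbb{L}^2$ (for small $\epsilon>0$ this is the principal branch). The volume (area) of a domain $U\subset\mathbb{K}^2$, possibly crossing $\partial\mathbb{H}^2$, is $\mu(U):=\lim_{\epsilon\to0^+}\int_U dV_\epsilon$. Transversality: a domain $U\subset\mathbb{K}^2$ is $C^{0,\beta}$-transversal to $\partial\mathbb{H}^2$ if, locally near each point where the boundary of $U$ meets $\partial\mathbb{H}^2$, the boundary of $U$ can be written in polar coordinates $(r,\theta)$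 as $\theta=g(r)$ for a $C^{0,\beta}$ (Hölder continuous with exponent $\beta$) function $g$. *)

theory Defs
  imports "HOL-Analysis.Analysis"
begin

text \<open>
  The affine chart \<open>{1} \<times> \<real>\<^sup>2\<close> of the extended hyperbolic plane is represented by \<^typ>\<open>real^2\<close>;
  the hyperbolic plane is \<^term>\<open>ball 0 1 :: (real^2) set\<close>, its ideal boundary is
  \<^term>\<open>sphere 0 1 :: (real^2) set\<close>.
\<close>

definition d_eps :: "real \<Rightarrow> complex" where
  "d_eps \<epsilon> = 1 - complex_of_real \<epsilon> * \<i>"

text \<open>
  Complex \<open>powr\<close> is the principal branch. For \<open>\<epsilon> > 0\<close> the base has imaginary part \<open>-2 * \<epsilon> < 0\<close>, so it
  never meets the branch cut. The lemmas \<open>dV_tendsto_H\<close> and \<open>dV_tendsto_L\<close> below identify the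
  limit density as \<open>\<epsilon> \<rightarrow> 0+\<close>.
\<close>

definition dV :: "real \<Rightarrow> real^2 \<Rightarrow> complex" where
  "dV \<epsilon> x = d_eps \<epsilon> / ((d_eps \<epsilon>)\<^sup>2 - complex_of_real ((norm x)\<^sup>2)) powr (3/2)"

text \<open>
  The integrability clause is needed because the library's integral of a non-integrable function
  is \<open>0\<close> by convention.
\<close>

definition has_area :: "(real^2) set \<Rightarrow> complex \<Rightarrow> bool" where
  "has_area U m \<longleftrightarrow>
     (\<forall>\<epsilon>>0. set_integrable lborel U (dV \<epsilon>)) \<and>
     ((\<lambda>\<epsilon>. LINT x:U|lborel. dV \<epsilon> x) \<longlongrightarrow> m) (at_right 0)"

definition holder_on :: "real \<Rightarrow> real set \<Rightarrow> (real \<Rightarrow> real) \<Rightarrow> bool" where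
  "holder_on \<beta> S g \<longleftrightarrow> (\<exists>C. \<forall>r\<in>S. \<forall>s\<in>S. \<bar>g r - g s\<bar> \<le> C * \<bar>r - s\<bar> powr \<beta>)"

definition polar :: "real \<Rightarrow> real \<Rightarrow> real^2" where
  "polar r \<theta> = vector [r * cos \<theta>, r * sin \<theta>]"

text \<open>
  The bound \<open>\<delta> < 1\<close> keeps the radial coordinate positive. The angle \<open>g r\<close> is an arbitrary real
  number, i.e. a lift of the angular coordinate.
\<close>

definition transversal :: "real \<Rightarrow> (real^2) set \<Rightarrow> bool" where
  "transversal \<beta> U \<longleftrightarrow>
     (\<forall>p \<in> frontier U \<inter> sphere 0 1.
        \<exists>N \<delta> g. open N \<and> p \<in> N \<and> 0 < \<delta> \<and> \<delta> < 1 \<and> holder_on \<beta> {1 - \<delta><..<1 + \<delta>} g \<and>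
          frontier U \<inter> N = {polar r (g r) |r. r \<in> {1 - \<delta><..<1 + \<delta>}} \<inter> N)"

lemma d_eps_tendsto: "(d_eps \<longlongrightarrow> 1) (at_right 0)"
proof -
  have "((\<lambda>\<epsilon>. 1 - complex_of_real \<epsilon> * \<i>) \<longlongrightarrow> 1 - complex_of_real 0 * \<i>) (at_right 0)"
    by (intro tendsto_intros)
  then show ?thesis by (simp add: d_eps_def[abs_def])
qed

lemma dV_tendsto_H:
  assumes "norm x < 1"
  shows "((\<lambda>\<epsilon>. dV \<epsilon> x) \<longlongrightarrow> complex_of_real (1 / (1 - (norm x)\<^sup>2) powr (3/2))) (at_right 0)"
proof -
  have pos: "1 - (norm x)\<^sup>2 > 0"
    using assms by (simp add: power_less_one_iff)
  let ?z = "complex_of_real (1 - (norm x)\<^sup>2)"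
  have nz: "?z \<notin> \<real>\<^sub>\<le>\<^sub>0"
    using pos by (simp only: complex_nonpos_Reals_iff) simp
  have base: "((\<lambda>\<epsilon>. (d_eps \<epsilon>)\<^sup>2 - complex_of_real ((norm x)\<^sup>2)) \<longlongrightarrow> ?z) (at_right 0)"
    using tendsto_diff[OF tendsto_power[OF d_eps_tendsto, of 2] tendsto_const[of "complex_of_real ((norm x)\<^sup>2)"]]
    by simp
  have "((\<lambda>\<epsilon>. dV \<epsilon> x) \<longlongrightarrow> 1 / ?z powr (3/2)) (at_right 0)"
    unfolding dV_def
    by (intro tendsto_divide d_eps_tendsto tendsto_powr_complex base nz tendsto_const)
       (use pos in \<open>simp_all only: powr_eq_0_iff of_real_eq_0_iff; simp\<close>)
  moreover have "?z powr (3/2) = complex_of_real ((1 - (norm x)\<^sup>2) powr (3/2))"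
    using powr_of_real[of "1 - (norm x)\<^sup>2" "3/2"] pos by simp
  ultimately show ?thesis by simp
qed

lemma dV_tendsto_L:
  assumes "norm x > 1"
  shows "((\<lambda>\<epsilon>. dV \<epsilon> x) \<longlongrightarrow> \<i> ^ 3 * complex_of_real (1 / ((norm x)\<^sup>2 - 1) powr (3/2))) (at_right 0)"
proof -
  have pos: "(norm x)\<^sup>2 - 1 > 0"
    using assms by (simp add: one_less_power)
  let ?w = "complex_of_real ((norm x)\<^sup>2 - 1)"
  define f where "f \<epsilon> = complex_of_real ((norm x)\<^sup>2) - (d_eps \<epsilon>)\<^sup>2" for \<epsilon>
  have nz: "?w \<notin> \<real>\<^sub>\<le>\<^sub>0"
    using pos by (simp only: complex_nonpos_Reals_iff) simp
  have base: "(f \<longlongrightarrow> ?w) (at_right 0)"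
    unfolding f_def
    using tendsto_diff[OF tendsto_const[of "complex_of_real ((norm x)\<^sup>2)"] tendsto_power[OF d_eps_tendsto, of 2]]
    by simp
  have wr: "?w powr (3/2) = complex_of_real (((norm x)\<^sup>2 - 1) powr (3/2))"
    using powr_of_real[of "(norm x)\<^sup>2 - 1" "3/2"] pos by simp
  have lim: "((\<lambda>\<epsilon>. d_eps \<epsilon> / (\<i> * f \<epsilon> powr (3/2))) \<longlongrightarrow> 1 / (\<i> * ?w powr (3/2))) (at_right 0)"
    by (intro tendsto_divide d_eps_tendsto tendsto_mult tendsto_powr_complex base nz tendsto_const)
       (use pos in \<open>simp only: mult_eq_0_iff powr_eq_0_iff of_real_eq_0_iff; simp\<close>)
  have "dV \<epsilon> x = d_eps \<epsilon> / (\<i> * f \<epsilon> powr (3/2))" if "\<epsilon> > 0" for \<epsilon>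
  proof -
    have im: "Im (f \<epsilon>) > 0"
      using that by (simp add: f_def d_eps_def power2_eq_square)
    then have f0: "f \<epsilon> \<noteq> 0" by auto
    have "Ln (- f \<epsilon>) = Ln (f \<epsilon>) - \<i> * pi"
      using im f0 by (subst Ln_minus) auto
    then have "(- f \<epsilon>) powr (3/2) = exp (3/2 * Ln (f \<epsilon>) - 3/2 * (\<i> * pi))"
      using f0 by (simp add: powr_def right_diff_distrib)
    also have "\<dots> = f \<epsilon> powr (3/2) / exp (3/2 * (\<i> * pi))"
      using f0 by (simp add: powr_def exp_diff)
    also have "exp (3/2 * (\<i> * pi)) = cis (3/2 * pi)"
      by (simp add: cis_conv_exp mult_ac)
    also have "cis (3/2 * pi) = - \<i>"
      by (simp only: complex_eq_iff cis.sel cos_3over2_pi sin_3over2_pi) simp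
    finally have "(- f \<epsilon>) powr (3/2) = \<i> * f \<epsilon> powr (3/2)"
      by simp
    then show ?thesis by (simp add: dV_def f_def)
  qed
  then have "\<forall>\<^sub>F \<epsilon> in at_right 0. d_eps \<epsilon> / (\<i> * f \<epsilon> powr (3/2)) = dV \<epsilon> x"
    by (auto simp: eventually_at_filter)
  from Lim_transform_eventually[OF lim this]
  have "((\<lambda>\<epsilon>. dV \<epsilon> x) \<longlongrightarrow> 1 / (\<i> * ?w powr (3/2))) (at_right 0)" .
  moreover have "1 / (\<i> * ?w powr (3/2)) = \<i> ^ 3 * complex_of_real (1 / ((norm x)\<^sup>2 - 1) powr (3/2))"
    unfolding wr using pos by (simp add: power3_eq_cube field_simps del: of_real_diff of_real_power)
  ultimately show ?thesis by simp
qed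

end

theory Submission
  imports Defs
begin

text \<open>
  The density blows up at the circle like \<open>\<bar>1 - |x|\<bar> powr (-3/2)\<close>, which is not integrable in the
  plane, so for a domain that crosses the circle the limit exists only through cancellation between
  the two sides. The cancellation is isolated by comparing \<open>U\<close> with the cone \<open>Z\<close> over \<open>U \<inter> S\<^sup>1\<close>,
  the set of all \<open>x \<noteq> 0\<close> with \<open>x / |x| \<in> U\<close>.

  On a cone the angular and the radial variable separate. The scaling behaviour of Lebesgue measure
  gives \<open>\<integral>\<^sub>Z f |x| dx = 2 \<kappa> \<integral> r f r dr\<close> over \<open>r \<ge> 0\<close>, where \<open>\<kappa>\<close> is the area of \<open>Z\<close> inside the unit
  disk, and \<open>r d\<^sub>\<epsilon> / (d\<^sub>\<epsilon>\<^sup>2 - r\<^sup>2) powr (3/2)\<close> has the primitive \<open>d\<^sub>\<epsilon> / (d\<^sub>\<epsilon>\<^sup>2 - r\<^sup>2) powr (1/2)\<close>, which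
  equals \<open>1\<close> at \<open>0\<close> and vanishes at infinity. Hence \<open>\<integral>\<^sub>Z dV\<^sub>\<epsilon> = - 2 \<kappa>\<close> for every \<open>\<epsilon> > 0\<close>
  (\<open>set_integral_dV_cone\<close>): for such \<open>\<epsilon>\<close> the primitive is smooth across \<open>r = 1\<close>, and its two
  boundary values do not depend on \<open>\<epsilon>\<close>.

  The rest, \<open>\<integral> (1\<^sub>U - 1\<^sub>Z) dV\<^sub>\<epsilon>\<close>, converges by dominated convergence. Since
  \<open>\<bar>d\<^sub>\<epsilon>\<^sup>2 - r\<^sup>2\<bar> \<ge> \<bar>1 - r\<^sup>2\<bar>\<close>, the integrand is bounded by a multiple of \<open>\<bar>1 - r\<^sup>2\<bar> powr (-3/2)\<close> on the
  symmetric difference of \<open>U\<close> and \<open>Z\<close>, and that function is integrable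
  (\<open>integrable_symmetric_difference_weight\<close>). This is where transversality enters. If exactly one of
  the points \<open>(r, \<theta>)\<close> and \<open>(1, \<theta>)\<close> lies in \<open>U\<close>, the radial segment between them meets the frontier curve
  \<open>\<theta> = g t\<close> at some \<open>t\<close> between \<open>1\<close> and \<open>r\<close>, whence \<open>\<bar>\<theta> - g 1\<bar> \<le> C \<bar>r - 1\<bar> powr \<beta>\<close> with
  \<open>\<beta> = 1/2 + \<alpha>\<close> (\<open>transversal_local\<close>). By compactness of the circle the symmetric difference lies,
  near the circle, in finitely many such sectors. The part of a sector at distance about
  \<open>\<rho>\<close> from the circle has area of order \<open>\<rho> powr (1 + \<beta>)\<close>, and the weight there has size
  \<open>\<rho> powr (-3/2)\<close>, so that dyadic shells contribute a geometric series with terms \<open>\<rho> powr \<alpha>\<close>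
  (\<open>holder_sector_majorant\<close>). The exponent \<open>1/2\<close> is exactly the threshold at which this series stops converging.
\<close>

section \<open>Radial integrals over cones\<close>

lemma emeasure_cone_cball:
  fixes Z :: "'a::euclidean_space set"
  assumes Z: "Z \<in> sets borel"
    and cone: "\<And>t x. 0 < t \<Longrightarrow> x \<in> Z \<Longrightarrow> t *\<^sub>R x \<in> Z"
    and r: "0 < r"
  shows "emeasure lborel (Z \<inter> cball 0 r) = ennreal (measure lborel (Z \<inter> cball 0 1) * r ^ DIM('a))"
proof -
  have eq: "Z \<inter> cball 0 r = (\<lambda>x. r *\<^sub>R x + 0) ` (Z \<inter> cball 0 1)" (is "_ = ?R")
  proof
    show "?R \<subseteq> Z \<inter> cball 0 r"
      using r cone by (auto simp: mult_left_le)
    show "Z \<inter> cball 0 r \<subseteq> ?R"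
    proof
      fix x assume x: "x \<in> Z \<inter> cball 0 r"
      have "inverse r *\<^sub>R x \<in> Z \<inter> cball 0 1"
        using x r cone[of "inverse r" x] by (auto simp: field_simps)
      moreover have "x = r *\<^sub>R (inverse r *\<^sub>R x) + 0"
        using r by simp
      ultimately show "x \<in> ?R" by blast
    qed
  qed
  have fin: "emeasure lborel (Z \<inter> cball 0 1) < \<infinity>"
    by (intro emeasure_bounded_finite bounded_Int) auto
  have "emeasure lborel (Z \<inter> cball 0 r) = emeasure lebesgue (Z \<inter> cball 0 r)"
    using Z by simp
  also have "\<dots> = ennreal (r ^ DIM('a)) * emeasure lebesgue (Z \<inter> cball 0 1)"
    unfolding eq using r by (subst emeasure_lebesgue_affine) simp
  also have "\<dots> = ennreal (r ^ DIM('a)) * ennreal (measure lborel (Z \<inter> cball 0 1))"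
    using Z fin by (simp add: emeasure_eq_ennreal_measure top.not_eq_extremum)
  finally show ?thesis
    using r by (simp add: ennreal_mult[symmetric] mult.commute)
qed

text \<open>
Polar integration over a cone, in the form of an identity of measures on the line. Only the volume
of the parts of the cone inside balls is involved, so homogeneity replaces a change of variables.
\<close>

lemma distr_norm_cone:
  fixes Z :: "'a::euclidean_space set"
  assumes Z: "Z \<in> sets borel"
    and cone: "\<And>t x. 0 < t \<Longrightarrow> x \<in> Z \<Longrightarrow> t *\<^sub>R x \<in> Z"
  shows "distr (density lborel (indicator Z)) borel norm =
    density lborel (\<lambda>r. ennreal (measure lborel (Z \<inter> cball 0 1) * DIM('a) * r ^ (DIM('a) - 1)) * indicator {0..} r)"
    (is "?M = density lborel ?f")
proof (rule measure_eqI_generator_eq)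
  let ?k = "measure lborel (Z \<inter> cball 0 1)"
  have M: "emeasure ?M {..a} = emeasure lborel (Z \<inter> cball 0 a)" for a
  proof -
    have "emeasure ?M {..a} = emeasure (density lborel (indicator Z)) (cball 0 a)"
      by (subst emeasure_distr) (auto intro!: arg_cong[where f="emeasure _"])
    also have "\<dots> = emeasure lborel (Z \<inter> cball 0 a)"
      using Z by (subst emeasure_density)
        (auto simp: nn_integral_indicator[symmetric] indicator_inter_arith simp del: nn_integral_indicator)
    finally show ?thesis .
  qed
  show "Int_stable (range atMost :: real set set)"
    by (auto simp: Int_stable_def image_iff)
  show "(range atMost :: real set set) \<subseteq> Pow UNIV" by simp
  show "sets ?M = sigma_sets UNIV (range atMost)" "sets (density lborel ?f) = sigma_sets UNIV (range atMost)"
    by (simp_all add: borel_eq_atMost[where 'a=real])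
  show "range (\<lambda>n::nat. {..real n}) \<subseteq> range atMost" by auto
  show "(\<Union>n::nat. {..real n}) = UNIV"
    using real_arch_simple by auto
  show "emeasure ?M {..real n} \<noteq> \<infinity>" for n :: nat
    using emeasure_bounded_finite[of "Z \<inter> cball 0 (real n)"] by (simp add: M bounded_Int less_top)
  fix X :: "real set" assume "X \<in> range atMost"
  then obtain a where X: "X = {..a}" by auto
  show "emeasure ?M X = emeasure (density lborel ?f) X"
  proof (cases "a \<ge> 0")
    case True
    have "emeasure (density lborel ?f) X = (\<integral>\<^sup>+r. ?f r * indicator {..a} r \<partial>lborel)"
      unfolding X by (subst emeasure_density) auto
    also have "\<dots> = (\<integral>\<^sup>+r. ennreal (?k * DIM('a) * r ^ (DIM('a) - 1)) * indicator {0..a} r \<partial>lborel)"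
      by (intro nn_integral_cong) (auto split: split_indicator)
    also have "\<dots> = ennreal (?k * a ^ DIM('a) - ?k * 0 ^ DIM('a))"
      using True by (intro nn_integral_FTC_Icc) (auto intro!: derivative_eq_intros)
    \<comment> \<open>Scaling by \<open>0\<close> says nothing about the apex of the cone, which is a null set.\<close>
    also have "\<dots> = emeasure lborel (Z \<inter> cball 0 a)"
    proof (cases "a = 0")
      case True
      have "emeasure lborel (Z \<inter> {0}) \<le> emeasure lborel {0::'a}"
        by (intro emeasure_mono) auto
      with True show ?thesis by simp
    next
      case False
      with \<open>a \<ge> 0\<close> show ?thesis using emeasure_cone_cball[OF Z cone, of a]
        by (simp add: zero_power)
    qed
    finally show ?thesis by (simp add: X M)
  next
    case False
    have "emeasure (density lborel ?f) X = (\<integral>\<^sup>+r. ?f r * indicator {..a} r \<partial>lborel)"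
      unfolding X by (subst emeasure_density) auto
    also have "\<dots> = (\<integral>\<^sup>+r. 0 \<partial>(lborel :: real measure))"
      using False by (intro nn_integral_cong) (auto split: split_indicator)
    finally show ?thesis using False by (simp add: X M)
  qed
qed

text \<open>
Two cones matter below: the one over the trace of the domain on the circle, where the exact value of
the integral is wanted, and the whole plane, which settles integrability at infinity.
\<close>

lemma
  fixes Z :: "'a::euclidean_space set" and f :: "real \<Rightarrow> 'b::{banach, second_countable_topology}"
  assumes Z: "Z \<in> sets borel"
    and cone: "\<And>t x. 0 < t \<Longrightarrow> x \<in> Z \<Longrightarrow> t *\<^sub>R x \<in> Z"
    and f [measurable]: "f \<in> borel_measurable borel"
  shows set_integrable_cone_radial:
      "set_integrable lborel {0..} (\<lambda>r. r ^ (DIM('a) - 1) *\<^sub>R f r) \<Longrightarrow>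
        set_integrable lborel Z (\<lambda>x. f (norm x))"
    and set_integral_cone_radial:
      "(LINT x:Z|lborel. f (norm x)) =
        (measure lborel (Z \<inter> cball 0 1) * DIM('a)) *\<^sub>R (LINT r:{0..}|lborel. r ^ (DIM('a) - 1) *\<^sub>R f r)"
proof -
  let ?k = "measure lborel (Z \<inter> cball 0 1)"
  let ?w = "\<lambda>r. ?k * DIM('a) * r ^ (DIM('a) - 1) * indicator {0..} r"
  have [measurable]: "Z \<in> sets lborel" using Z by simp
  have M: "density lborel (indicator Z) = density lborel (\<lambda>x. ennreal (indicator Z x))"
    by (intro density_cong) (auto split: split_indicator)
  have D: "distr (density lborel (indicator Z)) borel norm = density lborel (\<lambda>r. ennreal (?w r))"
    unfolding distr_norm_cone[OF Z cone, simplified]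
    by (intro density_cong) (auto split: split_indicator)
  have nn: "AE r in lborel. 0 \<le> ?w r"
    by (auto split: split_indicator)
  have "set_integrable lborel Z (\<lambda>x. f (norm x)) \<longleftrightarrow> integrable (density lborel (indicator Z)) (\<lambda>x. f (norm x))"
    unfolding M set_integrable_def by (subst integrable_density) auto
  also have "\<dots> \<longleftrightarrow> integrable (distr (density lborel (indicator Z)) borel norm) f"
    by (subst integrable_distr_eq) auto
  also have "\<dots> \<longleftrightarrow> integrable lborel (\<lambda>r. ?w r *\<^sub>R f r)"
    unfolding D by (subst integrable_density) (use nn in auto)
  also have "(\<lambda>r. ?w r *\<^sub>R f r) = (\<lambda>r. (?k * DIM('a)) *\<^sub>R (indicator {0..} r *\<^sub>R (r ^ (DIM('a) - 1) *\<^sub>R f r)))"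
    by (auto simp: mult_ac)
  finally show "set_integrable lborel Z (\<lambda>x. f (norm x))"
    if "set_integrable lborel {0..} (\<lambda>r. r ^ (DIM('a) - 1) *\<^sub>R f r)"
    using that[unfolded set_integrable_def] by (metis integrable_scaleR_right)
  have "(LINT x:Z|lborel. f (norm x)) = (LINT x|density lborel (indicator Z). f (norm x))"
    unfolding M set_lebesgue_integral_def by (subst integral_density) auto
  also have "\<dots> = (LINT r|distr (density lborel (indicator Z)) borel norm. f r)"
    by (subst integral_distr) auto
  also have "\<dots> = (LINT r|lborel. ?w r *\<^sub>R f r)"
    unfolding D by (subst integral_density) (use nn in auto)
  also have "\<dots> = (LINT r|lborel. (?k * DIM('a)) *\<^sub>R (indicator {0..} r *\<^sub>R (r ^ (DIM('a) - 1) *\<^sub>R f r)))"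
    by (intro Bochner_Integration.integral_cong) (auto simp: mult_ac)
  also have "\<dots> = (?k * DIM('a)) *\<^sub>R (LINT r:{0..}|lborel. r ^ (DIM('a) - 1) *\<^sub>R f r)"
    unfolding set_lebesgue_integral_def by (rule integral_scaleR_right)
  finally show "(LINT x:Z|lborel. f (norm x)) =
        (?k * DIM('a)) *\<^sub>R (LINT r:{0..}|lborel. r ^ (DIM('a) - 1) *\<^sub>R f r)" .
qed

section \<open>The density on a cone\<close>

definition radial_density :: "real \<Rightarrow> real \<Rightarrow> complex" where
  "radial_density \<epsilon> r = d_eps \<epsilon> / ((d_eps \<epsilon>)\<^sup>2 - complex_of_real (r\<^sup>2)) powr (3/2)"

lemma dV_eq_radial_density: "dV \<epsilon> x = radial_density \<epsilon> (norm x)"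
  by (simp add: dV_def radial_density_def)

lemma Im_density_base: "Im ((d_eps \<epsilon>)\<^sup>2 - (complex_of_real r)\<^sup>2) = - 2 * \<epsilon>"
  by (simp add: d_eps_def power2_eq_square)

lemma density_base_not_nonpos:
  assumes "\<epsilon> > 0"
  shows "(d_eps \<epsilon>)\<^sup>2 - complex_of_real (r\<^sup>2) \<notin> \<real>\<^sub>\<le>\<^sub>0"
  using assms by (auto simp: complex_nonpos_Reals_iff d_eps_def power2_eq_square)

lemma density_base_nonzero:
  assumes "\<epsilon> > 0"
  shows "(d_eps \<epsilon>)\<^sup>2 \<noteq> (complex_of_real r)\<^sup>2"
  using density_base_not_nonpos[OF assms, of r] by auto

lemma norm_density_base_ge:
  assumes "r \<ge> 0"
  shows "norm ((d_eps \<epsilon>)\<^sup>2 - complex_of_real (r\<^sup>2)) \<ge> sqrt ((1 - r)\<^sup>2 + \<epsilon>\<^sup>2) * (1 + r)"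
proof -
  have eq: "(d_eps \<epsilon>)\<^sup>2 - complex_of_real (r\<^sup>2) = (d_eps \<epsilon> - of_real r) * (d_eps \<epsilon> + of_real r)"
    by (simp add: power2_eq_square algebra_simps)
  have "norm (d_eps \<epsilon> - of_real r) = sqrt ((1 - r)\<^sup>2 + \<epsilon>\<^sup>2)"
    by (simp add: cmod_def d_eps_def)
  moreover have "norm (d_eps \<epsilon> + of_real r) \<ge> 1 + r"
    using complex_Re_le_cmod[of "d_eps \<epsilon> + of_real r"] by (simp add: d_eps_def)
  ultimately show ?thesis
    unfolding eq norm_mult by (simp add: mult_left_mono)
qed

text \<open>
The parameter \<open>m\<close> allows two uses: \<open>m = \<bar>1 - r\<bar>\<close> gives a bound off the circle that is uniform in
small \<open>\<epsilon>\<close>, while \<open>m = sqrt ((1 - r)\<^sup>2 + \<epsilon>\<^sup>2)\<close> gives, for fixed \<open>\<epsilon>\<close>, a bound for all \<open>r\<close>.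
\<close>

lemma norm_radial_density_le:
  assumes "\<epsilon> > 0" and "r \<ge> 0" and "0 < m" and "m \<le> sqrt ((1 - r)\<^sup>2 + \<epsilon>\<^sup>2)"
  shows "norm (radial_density \<epsilon> r) \<le> (1 + \<epsilon>) * (1 / (m * (1 + r)) powr (3/2))"
proof -
  have "norm (d_eps \<epsilon>) \<le> 1 + \<epsilon>"
    using norm_triangle_ineq4[of 1 "complex_of_real \<epsilon> * \<i>"] assms by (simp add: d_eps_def norm_mult)
  moreover have "m * (1 + r) \<le> norm ((d_eps \<epsilon>)\<^sup>2 - complex_of_real (r\<^sup>2))"
    using norm_density_base_ge[of r \<epsilon>] assms mult_right_mono[of m "sqrt ((1 - r)\<^sup>2 + \<epsilon>\<^sup>2)" "1 + r"] by linarith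
  then have "(m * (1 + r)) powr (3/2) \<le> norm ((d_eps \<epsilon>)\<^sup>2 - complex_of_real (r\<^sup>2)) powr (3/2)"
    using assms by (intro powr_mono2) auto
  moreover have "0 < (m * (1 + r)) powr (3/2)"
    using assms by simp
  moreover have "norm (radial_density \<epsilon> r) =
      norm (d_eps \<epsilon>) / norm ((d_eps \<epsilon>)\<^sup>2 - complex_of_real (r\<^sup>2)) powr (3/2)"
    by (simp add: radial_density_def norm_divide norm_powr_real_powr')
  ultimately show ?thesis
    using frac_le[of "1 + \<epsilon>" "norm (d_eps \<epsilon>)"] assms by simp
qed

text \<open>
A lower bound \<open>c\<close> for \<open>m\<close> that keeps away from the singularity, together with \<open>\<bar>1 - r\<bar> \<le> m\<close>, makes
\<open>m\<close> comparable to \<open>1 + r\<close>. The resulting cubic decay is integrable in the plane.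
\<close>

lemma inverse_powr_decay:
  fixes r c m :: real
  assumes "r \<ge> 0" "c > 0" "c \<le> m" "\<bar>1 - r\<bar> \<le> m"
  shows "1 / (m * (1 + r)) powr (3/2) \<le> (1 + 2 / c) powr (3/2) * (1 / (1 + r) ^ 3)"
proof -
  define K where "K = 1 + 2 / c"
  \<comment> \<open>The division is done once for abstract values, since simplification would expand the bases.\<close>
  have *: "1 / p \<le> k * (1 / q)" if "q \<le> k * p" "0 < p" "0 < q" for p q k :: real
    using that by (simp add: field_simps)
  have K: "K > 0" using assms by (auto simp: K_def add_pos_pos)
  have "2 \<le> 2 / c * m"
    using assms by (simp add: field_simps)
  then have "1 + r \<le> K * m"
    using assms by (simp add: K_def algebra_simps)
  then have "(1 + r) * (1 + r) \<le> (K * m) * (1 + r)"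
    using assms by (intro mult_right_mono) auto
  then have "((1 + r)\<^sup>2) powr (3/2) \<le> (K * (m * (1 + r))) powr (3/2)"
    using assms by (intro powr_mono2) (auto simp: power2_eq_square mult_ac)
  also have "\<dots> = K powr (3/2) * (m * (1 + r)) powr (3/2)"
    using assms K by (simp add: powr_mult)
  also have "((1 + r)\<^sup>2) powr (3/2) = (1 + r) ^ 3"
  proof -
    have "((1 + r)\<^sup>2) powr (3/2) = ((1 + r) powr 2) powr (3/2)"
      using assms by simp
    also have "\<dots> = (1 + r) powr 3"
      unfolding powr_powr by simp
    finally show ?thesis using assms by simp
  qed
  finally have "(1 + r) ^ 3 \<le> K powr (3/2) * (m * (1 + r)) powr (3/2)" .
  moreover have "0 < (m * (1 + r)) powr (3/2)" "0 < (1 + r) ^ 3"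
    using assms by auto
  ultimately show ?thesis
    unfolding K_def[symmetric] by (rule *)
qed

lemma set_integrable_inverse_cube:
  "set_integrable lborel {0..} (\<lambda>r::real. r *\<^sub>R (1 / (1 + r) ^ 3))"
proof -
  have "(\<integral>\<^sup>+r. ennreal (r * (1 / (1 + r) ^ 3)) * indicator {0..} r \<partial>lborel) =
      ennreal (0 - (- inverse (1 + 0) + (inverse (1 + 0))\<^sup>2 / 2))"
  proof (rule nn_integral_FTC_atLeast)
    fix r :: real assume "0 \<le> r"
    then have nz: "1 + r \<noteq> 0" by simp
    then have "(1 + r) * inverse (1 + r) = 1" by simp
    then have "r * (inverse (1 + r)) ^ 3 = inverse (1 + r) * inverse (1 + r) - inverse (1 + r) ^ 3"
      by algebra
    then have "r * (1 / (1 + r) ^ 3) = inverse (1 + r) * inverse (1 + r) - inverse (1 + r) ^ 3"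
      by (simp add: power_inverse divide_inverse)
    then show "((\<lambda>r. - inverse (1 + r) + (inverse (1 + r))\<^sup>2 / 2) has_real_derivative r * (1 / (1 + r) ^ 3)) (at r)"
      using nz by (auto intro!: derivative_eq_intros simp: power2_eq_square power3_eq_cube)
  next
    have *: "((\<lambda>r::real. inverse (1 + r)) \<longlongrightarrow> 0) at_top"
      by (intro tendsto_inverse_0_at_top filterlim_tendsto_add_at_top[OF tendsto_const filterlim_ident])
    have "((\<lambda>r::real. - inverse (1 + r) + (inverse (1 + r))\<^sup>2 / 2) \<longlongrightarrow> - 0 + 0\<^sup>2 / 2) at_top"
      by (intro tendsto_add tendsto_minus tendsto_divide tendsto_power tendsto_const *) simp
    then show "((\<lambda>r::real. - inverse (1 + r) + (inverse (1 + r))\<^sup>2 / 2) \<longlongrightarrow> 0) at_top"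
      by simp
  qed auto
  also have "(\<integral>\<^sup>+r. ennreal (r * (1 / (1 + r) ^ 3)) * indicator {0..} r \<partial>lborel) =
      (\<integral>\<^sup>+r. ennreal (indicator {0..} r *\<^sub>R (r *\<^sub>R (1 / (1 + r) ^ 3))) \<partial>lborel)"
    by (intro nn_integral_cong) (auto split: split_indicator)
  finally have "(\<integral>\<^sup>+r. ennreal (indicator {0..} r *\<^sub>R (r *\<^sub>R (1 / (1 + r) ^ 3))) \<partial>lborel) < \<infinity>"
    by (metis ennreal_less_top infinity_ennreal_def)
  then show ?thesis
    unfolding set_integrable_def
    by (intro integrableI_nonneg) (auto split: split_indicator)
qed

lemma integrable_norm_inverse_cube: "integrable lborel (\<lambda>x::real^2. 1 / (1 + norm x) ^ 3)"
proof -
  have "set_integrable lborel UNIV (\<lambda>x::real^2. 1 / (1 + norm x) ^ 3)"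
    by (rule set_integrable_cone_radial) (use set_integrable_inverse_cube in simp_all)
  then show ?thesis
    by (simp add: set_integrable_def)
qed

lemma continuous_density_base_powr:
  assumes "\<epsilon> > 0"
  shows "continuous_on A (\<lambda>r. ((d_eps \<epsilon>)\<^sup>2 - complex_of_real (r\<^sup>2)) powr s)"
proof (rule continuous_on_powr_complex)
  show "A \<subseteq> {r. 0 \<le> Re ((d_eps \<epsilon>)\<^sup>2 - complex_of_real (r\<^sup>2)) \<or> Im ((d_eps \<epsilon>)\<^sup>2 - complex_of_real (r\<^sup>2)) \<noteq> 0}"
    using assms by (simp only: of_real_power Im_density_base) auto
  show "(d_eps \<epsilon>)\<^sup>2 - complex_of_real (r\<^sup>2) = 0 \<Longrightarrow> 0 < Re s" for r
    using density_base_nonzero[OF assms, of r] by simp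
qed (intro continuous_intros)+

lemma continuous_radial_density:
  assumes "\<epsilon> > 0"
  shows "continuous_on A (radial_density \<epsilon>)"
proof -
  have "((d_eps \<epsilon>)\<^sup>2 - complex_of_real (r\<^sup>2)) powr (3/2) \<noteq> 0" for r
    using density_base_nonzero[OF assms, of r] by simp
  then show ?thesis
    unfolding radial_density_def[abs_def]
    by (intro continuous_on_divide continuous_on_const continuous_density_base_powr assms) simp
qed

lemma borel_measurable_radial_density [measurable]:
  "\<epsilon> > 0 \<Longrightarrow> radial_density \<epsilon> \<in> borel_measurable borel"
  by (intro borel_measurable_continuous_onI continuous_radial_density)

lemma set_integrable_radial_density:
  assumes \<epsilon>: "\<epsilon> > 0"
  shows "set_integrable lborel {0..} (\<lambda>r. r *\<^sub>R radial_density \<epsilon> r)"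
proof -
  have "set_integrable lborel {0..} (\<lambda>r. ((1 + \<epsilon>) * (1 + 2 / \<epsilon>) powr (3/2)) * (r *\<^sub>R (1 / (1 + r) ^ 3)))"
    by (rule set_integrable_mult_right) (rule set_integrable_inverse_cube)
  then show ?thesis
  proof (rule set_integrable_bound)
    show "set_borel_measurable lborel {0..} (\<lambda>r. r *\<^sub>R radial_density \<epsilon> r)"
      using \<epsilon> by (simp add: set_borel_measurable_def)
    show "AE r in lborel. r \<in> {0..} \<longrightarrow> norm (r *\<^sub>R radial_density \<epsilon> r) \<le>
        norm (((1 + \<epsilon>) * (1 + 2 / \<epsilon>) powr (3/2)) * (r *\<^sub>R (1 / (1 + r) ^ 3)))"
    proof (intro AE_I2 impI)
      fix r :: real assume "r \<in> {0..}"
      then have r: "0 \<le> r" by simp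
      let ?m = "sqrt ((1 - r)\<^sup>2 + \<epsilon>\<^sup>2)"
      have m: "\<epsilon> \<le> ?m" "\<bar>1 - r\<bar> \<le> ?m"
        by (auto intro!: real_le_rsqrt)
      have "norm (radial_density \<epsilon> r) \<le> (1 + \<epsilon>) * (1 / (?m * (1 + r)) powr (3/2))"
        using m \<epsilon> r by (intro norm_radial_density_le) linarith+
      also have "\<dots> \<le> (1 + \<epsilon>) * ((1 + 2 / \<epsilon>) powr (3/2) * (1 / (1 + r) ^ 3))"
        using m \<epsilon> r by (intro mult_left_mono inverse_powr_decay) auto
      finally have "r * norm (radial_density \<epsilon> r) \<le> r * ((1 + \<epsilon>) * ((1 + 2 / \<epsilon>) powr (3/2) * (1 / (1 + r) ^ 3)))"
        using r by (intro mult_left_mono) auto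
      then show "norm (r *\<^sub>R radial_density \<epsilon> r) \<le>
        norm (((1 + \<epsilon>) * (1 + 2 / \<epsilon>) powr (3/2)) * (r *\<^sub>R (1 / (1 + r) ^ 3)))"
        using r \<epsilon> by (simp add: abs_mult mult_ac)
    qed
  qed
qed

text \<open>
The exact evaluation behind the cancellation. For \<open>\<epsilon> > 0\<close> the base \<open>d\<^sub>\<epsilon>\<^sup>2 - r\<^sup>2\<close> has negative
imaginary part, so along the whole half-line the principal branch is smooth and a primitive is
available across \<open>r = 1\<close>.
\<close>

lemma integral_radial_density:
  assumes \<epsilon>: "\<epsilon> > 0"
  shows "(LINT r:{0..}|lborel. r *\<^sub>R radial_density \<epsilon> r) = - 1"
proof -
  let ?w = "\<lambda>r. (d_eps \<epsilon>)\<^sup>2 - complex_of_real (r\<^sup>2)"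
  let ?G = "\<lambda>r. d_eps \<epsilon> * ?w r powr (- 1/2)"
  have int: "set_integrable lborel {0<..} (\<lambda>r. r *\<^sub>R radial_density \<epsilon> r)"
    using set_integrable_radial_density[OF \<epsilon>] by (rule set_integrable_subset) auto
  have G0: "?G 0 = 1"
  proof -
    have d: "Re (d_eps \<epsilon>) > 0" by (simp add: d_eps_def)
    \<comment> \<open>\<open>d\<^sub>\<epsilon>\<close> lies in the right half-plane, so it is the principal root of its square.\<close>
    have "((d_eps \<epsilon>)\<^sup>2) powr (1/2) = d_eps \<epsilon>"
      using csqrt_square[of "d_eps \<epsilon>"] d by (subst csqrt_conv_powr[symmetric]) auto
    then show ?thesis
      using d by (auto simp: powr_minus field_simps)
  qed
  have cont: "continuous_on UNIV ?G"
    by (intro continuous_on_mult continuous_on_const continuous_density_base_powr \<epsilon>)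
  have "(LBINT r=0..\<infinity>. r *\<^sub>R radial_density \<epsilon> r) = 0 - 1"
  proof (rule interval_integral_FTC_integrable[where F = ?G])
    fix r :: real assume "0 < ereal r"
    have "((\<lambda>z. (d_eps \<epsilon>)\<^sup>2 - z\<^sup>2) has_field_derivative - (2 * of_real r)) (at (complex_of_real r))"
      by (auto intro!: derivative_eq_intros)
    with density_base_not_nonpos[OF \<epsilon>, of r]
    have "((\<lambda>z. ((d_eps \<epsilon>)\<^sup>2 - z\<^sup>2) powr (- 1/2)) has_field_derivative
        (- 1/2 * ((d_eps \<epsilon>)\<^sup>2 - (of_real r)\<^sup>2) powr (- 1/2 - 1) * (- (2 * of_real r)))) (at (complex_of_real r))"
      by (intro has_field_derivative_powr[THEN DERIV_chain2]) (simp_all only: of_real_power not_False_eq_True)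
    from has_vector_derivative_real_field[OF DERIV_cmult[OF this, of "d_eps \<epsilon>"]]
    have "(?G has_vector_derivative d_eps \<epsilon> * (- 1/2 * ?w r powr (- 1/2 - 1) * (- (2 * of_real r)))) (at r)"
      by (simp only: of_real_power)
    also have "d_eps \<epsilon> * (- 1/2 * ?w r powr (- 1/2 - 1) * (- (2 * of_real r))) = r *\<^sub>R radial_density \<epsilon> r"
    proof -
      have e: "- 1/2 - 1 = - (3/2 :: complex)" by simp
      show ?thesis
        unfolding e powr_minus radial_density_def scaleR_conv_of_real divide_inverse by (simp only: mult_ac) (simp add: powr_minus)
    qed
    finally show "(?G has_vector_derivative r *\<^sub>R radial_density \<epsilon> r) (at r)" .
    show "isCont (\<lambda>r. r *\<^sub>R radial_density \<epsilon> r) r"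
      using continuous_radial_density[OF \<epsilon>, of UNIV]
      by (intro continuous_intros) (auto simp: continuous_on_eq_continuous_at)
  next
    show "set_integrable lborel (einterval 0 \<infinity>) (\<lambda>r. r *\<^sub>R radial_density \<epsilon> r)"
      using int by (simp add: einterval_eq zero_ereal_def)
    have "(?G \<longlongrightarrow> ?G 0) (at 0)"
      using cont by (simp only: continuous_on_eq_continuous_at[OF open_UNIV] isCont_def ball_UNIV)
    then show "((?G \<circ> real_of_ereal) \<longlongrightarrow> 1) (at_right 0)"
      unfolding zero_ereal_def ereal_tendsto_simps G0 by (rule filterlim_mono) (auto simp: at_le)
    show "((?G \<circ> real_of_ereal) \<longlongrightarrow> 0) (at_left \<infinity>)"
      unfolding ereal_tendsto_simps
    proof (rule Lim_null_comparison)
      show "\<forall>\<^sub>F r in at_top. norm (?G r) \<le> norm (d_eps \<epsilon>) * (\<epsilon> * (1 + r)) powr (- 1/2)"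
        using eventually_ge_at_top[of 0]
      proof eventually_elim
        case (elim r)
        have "\<epsilon> \<le> sqrt ((1 - r)\<^sup>2 + \<epsilon>\<^sup>2)" by (auto intro!: real_le_rsqrt)
        then have "\<epsilon> * (1 + r) \<le> norm (?w r)"
          using norm_density_base_ge[OF elim, of \<epsilon>] mult_right_mono[of \<epsilon> "sqrt ((1 - r)\<^sup>2 + \<epsilon>\<^sup>2)" "1 + r"] elim by linarith
        then have "norm (?w r) powr (- 1/2) \<le> (\<epsilon> * (1 + r)) powr (- 1/2)"
          using elim \<epsilon> by (intro powr_mono2') auto
        then show ?case
          by (simp add: norm_mult norm_powr_real_powr' mult_left_mono)
      qed
      have "((\<lambda>r. (\<epsilon> * (1 + r)) powr (- 1/2)) \<longlongrightarrow> 0) at_top"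
        using \<epsilon> by (intro tendsto_neg_powr filterlim_tendsto_pos_mult_at_top[OF tendsto_const]
          filterlim_tendsto_add_at_top[OF tendsto_const filterlim_ident]) auto
      from tendsto_mult_right_zero[OF this]
      show "((\<lambda>r. norm (d_eps \<epsilon>) * (\<epsilon> * (1 + r)) powr (- 1/2)) \<longlongrightarrow> 0) at_top" .
    qed
  qed simp
  also have "(LBINT r=0..\<infinity>. r *\<^sub>R radial_density \<epsilon> r) = (LINT r:{0<..}|lborel. r *\<^sub>R radial_density \<epsilon> r)"
    by (simp add: interval_integral_to_infinity_eq zero_ereal_def)
  \<comment> \<open>The integrand vanishes at the endpoint \<open>0\<close>.\<close>
  also have "\<dots> = (LINT r:{0..}|lborel. r *\<^sub>R radial_density \<epsilon> r)"
    unfolding set_lebesgue_integral_def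
    by (intro Bochner_Integration.integral_cong) (auto split: split_indicator)
  finally show ?thesis by simp
qed

lemma
  fixes Z :: "(real^2) set"
  assumes \<epsilon>: "\<epsilon> > 0"
    and Z: "Z \<in> sets borel"
    and cone: "\<And>t x. 0 < t \<Longrightarrow> x \<in> Z \<Longrightarrow> t *\<^sub>R x \<in> Z"
  shows set_integrable_dV_cone: "set_integrable lborel Z (dV \<epsilon>)"
    and set_integral_dV_cone: "(LINT x:Z|lborel. dV \<epsilon> x) = - of_real (2 * measure lborel (Z \<inter> cball 0 1))"
  using set_integrable_cone_radial[OF Z cone, of "radial_density \<epsilon>"]
    set_integral_cone_radial[OF Z cone, of "radial_density \<epsilon>"]
    set_integrable_radial_density[OF \<epsilon>] integral_radial_density[OF \<epsilon>] \<epsilon>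
  by (simp_all add: dV_eq_radial_density[abs_def] scaleR_conv_of_real)

section \<open>The frontier near the circle\<close>

lemma polar_components [simp]: "polar r \<theta> $ 1 = r * cos \<theta>" "polar r \<theta> $ 2 = r * sin \<theta>"
  by (simp_all add: polar_def)

lemma norm_polar [simp]: "norm (polar r \<theta>) = \<bar>r\<bar>"
proof -
  have "(r * cos \<theta>)\<^sup>2 + (r * sin \<theta>)\<^sup>2 = r\<^sup>2 * ((cos \<theta>)\<^sup>2 + (sin \<theta>)\<^sup>2)"
    by (simp only: power_mult_distrib distrib_left)
  then have "(r * cos \<theta>)\<^sup>2 + (r * sin \<theta>)\<^sup>2 = r\<^sup>2"
    by simp
  then show ?thesis
    by (simp add: norm_vec_def L2_set_def sum_2)
qed

lemma polar_eq_scaleR: "polar r \<theta> = r *\<^sub>R polar 1 \<theta>"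
  by (simp add: vec_eq_iff forall_2)

lemma sgn_polar: "r > 0 \<Longrightarrow> sgn (polar r \<theta>) = polar 1 \<theta>"
  by (simp add: sgn_div_norm vec_eq_iff forall_2)

lemma exists_polar_angle:
  obtains \<theta> where "\<theta> \<in> {0..2 * pi}" "x = polar (norm x) \<theta>"
proof (cases "x = 0")
  case True
  then have "x = polar (norm x) 0"
    by (simp add: vec_eq_iff forall_2)
  then show ?thesis
    by (rule that[rotated]) simp
next
  case False
  have "(x $ 1 / norm x)\<^sup>2 + (x $ 2 / norm x)\<^sup>2 = (x \<bullet> x) / (norm x)\<^sup>2"
    by (simp add: inner_vec_def sum_2 power_divide add_divide_distrib power2_eq_square)
  also have "\<dots> = 1"
    using False by (simp add: power2_norm_eq_inner)
  finally obtain t where t: "0 \<le> t" "t < 2 * pi" "x $ 1 / norm x = cos t" "x $ 2 / norm x = sin t"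
    by (rule sincos_total_2pi)
  have "x = polar (norm x) t"
    unfolding vec_eq_iff forall_2 polar_components t(3,4)[symmetric] using False by simp
  then show ?thesis
    by (rule that[rotated]) (use t in simp)
qed

lemma polar_eqD:
  assumes "polar r \<theta> = polar s \<phi>" and "r > 0" and "s > 0"
  shows "r = s" and "\<exists>k::int. \<theta> = \<phi> + 2 * pi * k"
proof -
  have "norm (polar r \<theta>) = norm (polar s \<phi>)"
    by (simp only: assms(1))
  then show rs: "r = s"
    unfolding norm_polar using assms(2,3) by simp
  have "polar r \<theta> $ 1 = polar s \<phi> $ 1" "polar r \<theta> $ 2 = polar s \<phi> $ 2"
    by (simp_all only: assms(1))
  then have "cos \<theta> = cos \<phi>" "sin \<theta> = sin \<phi>"
    unfolding polar_components using assms(3) rs by auto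
  then show "\<exists>k::int. \<theta> = \<phi> + 2 * pi * k"
    using sin_cos_eq_iff[of \<theta> \<phi>] by (auto simp: mult_ac)
qed

lemma continuous_on_polar [continuous_intros]:
  fixes A :: "'a::t2_space set"
  assumes "continuous_on A f" "continuous_on A g"
  shows "continuous_on A (\<lambda>z. polar (f z) (g z))"
proof -
  have "(\<lambda>z. polar (f z) (g z)) = (\<lambda>z. \<chi> i. if i = 1 then f z * cos (g z) else f z * sin (g z))"
    by (simp add: fun_eq_iff vec_eq_iff forall_2)
  moreover have "continuous_on A (\<lambda>z. if i = 1 then f z * cos (g z) else f z * sin (g z))" for i :: 2
    using assms by (cases "i = 1") (auto intro!: continuous_on_mult continuous_on_cos continuous_on_sin)
  ultimately show ?thesis
    by (simp only: continuous_on_vec_lambda)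
qed

lemma polar_box_subset:
  assumes "open N" and "polar r\<^sub>0 \<theta>\<^sub>0 \<in> N"
  obtains e where "e > 0" "\<And>r \<theta>. \<bar>r - r\<^sub>0\<bar> < e \<Longrightarrow> \<bar>\<theta> - \<theta>\<^sub>0\<bar> < e \<Longrightarrow> polar r \<theta> \<in> N"
proof -
  have "open ((\<lambda>z. polar (fst z) (snd z)) -` N)"
    using assms(1) by (rule open_vimage) (intro continuous_intros)
  moreover have "(r\<^sub>0, \<theta>\<^sub>0) \<in> (\<lambda>z. polar (fst z) (snd z)) -` N"
    using assms(2) by simp
  ultimately obtain A B where AB: "open A" "open B" "r\<^sub>0 \<in> A" "\<theta>\<^sub>0 \<in> B"
      "A \<times> B \<subseteq> (\<lambda>z. polar (fst z) (snd z)) -` N"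
    by (auto elim!: open_prod_elim)
  from AB(1,3) obtain a where a: "a > 0" "\<And>r. \<bar>r - r\<^sub>0\<bar> < a \<Longrightarrow> r \<in> A"
    unfolding open_dist dist_real_def by blast
  from AB(2,4) obtain b where b: "b > 0" "\<And>\<theta>. \<bar>\<theta> - \<theta>\<^sub>0\<bar> < b \<Longrightarrow> \<theta> \<in> B"
    unfolding open_dist dist_real_def by blast
  show ?thesis
  proof (rule that[of "min a b"])
    fix r \<theta> assume "\<bar>r - r\<^sub>0\<bar> < min a b" "\<bar>\<theta> - \<theta>\<^sub>0\<bar> < min a b"
    then have "(r, \<theta>) \<in> A \<times> B"
      using a(2) b(2) by simp
    with AB(5) show "polar r \<theta> \<in> N" by auto
  qed (use a b in simp)
qed

text \<open>
A radial segment, rather than a path adapted to the frontier curve, is enough: it avoids any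
discussion of the two sides of the curve.
\<close>

lemma radial_segment_meets_frontier:
  assumes "(polar r \<theta> \<in> U) \<noteq> (polar s \<theta> \<in> U)"
  obtains t where "t \<in> closed_segment s r" "polar t \<theta> \<in> frontier U"
proof -
  let ?S = "(\<lambda>t. polar t \<theta>) ` closed_segment s r"
  have "connected ?S"
    by (intro connected_continuous_image continuous_intros) auto
  moreover have "?S \<inter> U \<noteq> {}" "?S - U \<noteq> {}"
    using assms by (auto simp: image_iff intro: ends_in_segment)
  ultimately have "?S \<inter> frontier U \<noteq> {}"
    by (rule connected_Int_frontier)
  then show ?thesis using that by auto
qed

text \<open>
If \<open>\<theta>\<^sub>0\<close> is the angle of a frontier point and exactly one end of the radial segment from \<open>(1, \<theta>)\<close> to
\<open>(r, \<theta>)\<close> lies in \<open>U\<close>, the segment crosses the frontier curve at a point with \<open>\<theta> = g t\<close>, and \<open>g\<close> moves by at most \<open>C \<bar>t - 1\<bar> powr \<beta> \<le> C \<bar>r - 1\<bar> powr \<beta>\<close>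
away from \<open>\<theta>\<^sub>0\<close>. If \<open>\<theta>\<^sub>0\<close> is not the angle of a frontier point, short
segments near \<open>(1, \<theta>\<^sub>0)\<close> do not cross the frontier.
\<close>

lemma transversal_local:
  assumes U: "transversal \<beta> U" and \<beta>: "\<beta> > 0"
  shows "\<exists>e>0. \<exists>C\<ge>0. \<forall>r \<theta>. \<bar>r - 1\<bar> < e \<longrightarrow> \<bar>\<theta> - \<theta>\<^sub>0\<bar> < e \<longrightarrow>
    (polar r \<theta> \<in> U) \<noteq> (polar 1 \<theta> \<in> U) \<longrightarrow> \<bar>\<theta> - \<theta>\<^sub>0\<bar> \<le> C * \<bar>r - 1\<bar> powr \<beta>"
proof (cases "polar 1 \<theta>\<^sub>0 \<in> frontier U")
  case False
  then obtain e where e: "e > 0" "\<And>r \<theta>. \<bar>r - 1\<bar> < e \<Longrightarrow> \<bar>\<theta> - \<theta>\<^sub>0\<bar> < e \<Longrightarrow> polar r \<theta> \<in> - frontier U"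
    using polar_box_subset[of "- frontier U" 1 \<theta>\<^sub>0] by (auto simp: open_Compl)
  have "(polar r \<theta> \<in> U) = (polar 1 \<theta> \<in> U)" if "\<bar>r - 1\<bar> < e" "\<bar>\<theta> - \<theta>\<^sub>0\<bar> < e" for r \<theta>
  proof (rule ccontr)
    assume "(polar r \<theta> \<in> U) \<noteq> (polar 1 \<theta> \<in> U)"
    then obtain t where "t \<in> closed_segment 1 r" "polar t \<theta> \<in> frontier U"
      by (rule radial_segment_meets_frontier)
    with e(2)[of t \<theta>] that segment_bound(1)[of t 1 r] show False by (simp add: abs_minus_commute)
  qed
  then have "\<forall>r \<theta>. \<bar>r - 1\<bar> < e \<longrightarrow> \<bar>\<theta> - \<theta>\<^sub>0\<bar> < e \<longrightarrow>
      (polar r \<theta> \<in> U) \<noteq> (polar 1 \<theta> \<in> U) \<longrightarrow> \<bar>\<theta> - \<theta>\<^sub>0\<bar> \<le> 0 * \<bar>r - 1\<bar> powr \<beta>"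
    by blast
  with e(1) show ?thesis by (meson order_refl)
next
  case True
  then have "polar 1 \<theta>\<^sub>0 \<in> frontier U \<inter> sphere 0 1" by simp
  with U obtain N \<delta> g where N: "open N" "polar 1 \<theta>\<^sub>0 \<in> N" "0 < \<delta>" "\<delta> < 1"
      and hol: "holder_on \<beta> {1 - \<delta><..<1 + \<delta>} g"
      and graph: "frontier U \<inter> N = {polar r (g r) |r. r \<in> {1 - \<delta><..<1 + \<delta>}} \<inter> N"
    unfolding transversal_def by meson
  have on_graph: "\<exists>k::int. \<theta> = g t + 2 * pi * k" if "polar t \<theta> \<in> frontier U \<inter> N" "t > 0" for t \<theta>
  proof -
    from that(1) obtain s where "s \<in> {1 - \<delta><..<1 + \<delta>}" "polar t \<theta> = polar s (g s)"
      unfolding graph by blast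
    with polar_eqD[of t \<theta> s "g s"] that(2) N(4) show ?thesis by auto
  qed
  from on_graph[of 1 \<theta>\<^sub>0] True N obtain k :: int where k: "\<theta>\<^sub>0 = g 1 + 2 * pi * k" by auto
  from hol obtain C\<^sub>0 where C\<^sub>0: "\<And>r s. r \<in> {1 - \<delta><..<1 + \<delta>} \<Longrightarrow> s \<in> {1 - \<delta><..<1 + \<delta>} \<Longrightarrow>
      \<bar>g r - g s\<bar> \<le> C\<^sub>0 * \<bar>r - s\<bar> powr \<beta>"
    unfolding holder_on_def by blast
  define C where "C = \<bar>C\<^sub>0\<bar>"
  have hC: "\<bar>g t - g 1\<bar> \<le> C * \<bar>t - 1\<bar> powr \<beta>" if "\<bar>t - 1\<bar> < \<delta>" for t
  proof -
    have "\<bar>g t - g 1\<bar> \<le> C\<^sub>0 * \<bar>t - 1\<bar> powr \<beta>"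
      using that N by (intro C\<^sub>0) auto
    also have "\<dots> \<le> C * \<bar>t - 1\<bar> powr \<beta>"
      unfolding C_def by (intro mult_right_mono) auto
    finally show ?thesis .
  qed
  obtain a where a: "a > 0" "\<And>r \<theta>. \<bar>r - 1\<bar> < a \<Longrightarrow> \<bar>\<theta> - \<theta>\<^sub>0\<bar> < a \<Longrightarrow> polar r \<theta> \<in> N"
    using polar_box_subset[OF N(1,2)] by blast
  \<comment> \<open>At radial distance \<open>h\<close> the curve moves by an angle less than \<open>1\<close>. With \<open>\<bar>\<theta> - \<theta>\<^sub>0\<bar> < 1\<close> this leaves no
    room for a multiple of \<open>2 \<pi>\<close>, so the lifts of all angles below agree.\<close>
  define h where "h = (1 / (C + 1)) powr (1 / \<beta>)"
  have C: "C \<ge> 0" by (simp add: C_def)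
  then have h0: "h > 0" by (simp add: h_def)
  have "h powr \<beta> = 1 / (C + 1)"
    unfolding h_def powr_powr using \<beta> C by simp
  then have h1: "C * h powr \<beta> < 1"
    using C by simp
  define e where "e = min (min a \<delta>) (min h 1)"
  have "\<bar>\<theta> - \<theta>\<^sub>0\<bar> \<le> C * \<bar>r - 1\<bar> powr \<beta>"
    if r: "\<bar>r - 1\<bar> < e" and \<theta>: "\<bar>\<theta> - \<theta>\<^sub>0\<bar> < e" and ne: "(polar r \<theta> \<in> U) \<noteq> (polar 1 \<theta> \<in> U)" for r \<theta>
  proof -
    from ne obtain t where t: "t \<in> closed_segment 1 r" "polar t \<theta> \<in> frontier U"
      by (rule radial_segment_meets_frontier)
    have tr: "\<bar>t - 1\<bar> \<le> \<bar>r - 1\<bar>"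
      using segment_bound(1)[OF t(1)] by (simp add: norm_minus_commute)
    with r \<theta> have te: "\<bar>t - 1\<bar> < 1" "\<bar>t - 1\<bar> < a" "\<bar>\<theta> - \<theta>\<^sub>0\<bar> < a" "\<bar>t - 1\<bar> < \<delta>" "\<bar>t - 1\<bar> \<le> h" "\<bar>\<theta> - \<theta>\<^sub>0\<bar> < 1"
      by (auto simp: e_def)
    from te(1) have "t > 0" by linarith
    with te a(2) t(2) obtain j :: int where j: "\<theta> = g t + 2 * pi * j"
      using on_graph[of t \<theta>] by blast
    have "C * \<bar>t - 1\<bar> powr \<beta> \<le> C * h powr \<beta>"
      using te \<beta> by (intro mult_left_mono powr_mono2) (auto simp: C_def)
    then have "\<bar>g t - g 1\<bar> < 1"
      using hC[OF te(4)] h1 by linarith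
    moreover have eq: "\<theta> - \<theta>\<^sub>0 = (g t - g 1) + 2 * pi * of_int (j - k)"
      by (simp add: j k algebra_simps)
    ultimately have "2 * pi * \<bar>of_int (j - k)\<bar> < 2"
      using te(6) by (simp add: abs_mult)
    then have "2 * pi * \<bar>real_of_int (j - k)\<bar> < 2 * pi * 1"
      using pi_gt3 by linarith
    then have "\<bar>real_of_int (j - k)\<bar> < 1"
      by (simp only: mult_less_cancel_left_pos[of "2 * pi"] pi_gt_zero mult_pos_pos zero_less_numeral)
    then have "j = k" by linarith
    with eq have "\<bar>\<theta> - \<theta>\<^sub>0\<bar> = \<bar>g t - g 1\<bar>" by simp
    also note hC[OF te(4)]
    also have "C * \<bar>t - 1\<bar> powr \<beta> \<le> C * \<bar>r - 1\<bar> powr \<beta>"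
      using tr \<beta> by (intro mult_left_mono powr_mono2) (auto simp: C_def)
    finally show ?thesis .
  qed
  moreover have "e > 0" using a N h0 by (simp add: e_def)
  ultimately show ?thesis using C by blast
qed

text \<open>
Compactness of the circle makes the radius and the constant uniform, at the price of finitely many
sectors.
\<close>

lemma transversal_uniform:
  assumes U: "transversal \<beta> U" and \<beta>: "\<beta> > 0"
  obtains T e C where "finite T" "0 < e" "e \<le> 1" "0 \<le> C"
    "\<And>r \<theta>. \<bar>r - 1\<bar> < e \<Longrightarrow> \<theta> \<in> {0..2 * pi} \<Longrightarrow> (polar r \<theta> \<in> U) \<noteq> (polar 1 \<theta> \<in> U) \<Longrightarrow>
      \<exists>\<theta>\<^sub>0\<in>T. \<bar>\<theta> - \<theta>\<^sub>0\<bar> \<le> C * \<bar>r - 1\<bar> powr \<beta>"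
proof -
  obtain e C where eC: "\<And>\<theta>\<^sub>0. e \<theta>\<^sub>0 > 0" "\<And>\<theta>\<^sub>0. C \<theta>\<^sub>0 \<ge> 0"
      "\<And>\<theta>\<^sub>0 r \<theta>. \<bar>r - 1\<bar> < e \<theta>\<^sub>0 \<Longrightarrow> \<bar>\<theta> - \<theta>\<^sub>0\<bar> < e \<theta>\<^sub>0 \<Longrightarrow>
        (polar r \<theta> \<in> U) \<noteq> (polar 1 \<theta> \<in> U) \<Longrightarrow> \<bar>\<theta> - \<theta>\<^sub>0\<bar> \<le> C \<theta>\<^sub>0 * \<bar>r - 1\<bar> powr \<beta>"
  proof -
    let ?P = "\<lambda>\<theta>\<^sub>0 (e, C). 0 < e \<and> 0 \<le> C \<and> (\<forall>r \<theta>. \<bar>r - 1\<bar> < e \<longrightarrow> \<bar>\<theta> - \<theta>\<^sub>0\<bar> < e \<longrightarrow>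
        (polar r \<theta> \<in> U) \<noteq> (polar 1 \<theta> \<in> U) \<longrightarrow> \<bar>\<theta> - \<theta>\<^sub>0\<bar> \<le> C * \<bar>r - 1\<bar> powr \<beta>)"
    have "\<forall>\<theta>\<^sub>0. \<exists>z. ?P \<theta>\<^sub>0 z"
    proof
      fix \<theta>\<^sub>0
      obtain e C where "?P \<theta>\<^sub>0 (e, C)"
        using transversal_local[OF assms, of \<theta>\<^sub>0] unfolding prod.case by meson
      then show "\<exists>z. ?P \<theta>\<^sub>0 z" by (rule exI)
    qed
    then obtain z where "\<forall>\<theta>\<^sub>0. ?P \<theta>\<^sub>0 (z \<theta>\<^sub>0)"
      by (rule choice[THEN exE])
    then show thesis
      by (intro that[of "\<lambda>\<theta>\<^sub>0. fst (z \<theta>\<^sub>0)" "\<lambda>\<theta>\<^sub>0. snd (z \<theta>\<^sub>0)"]) (unfold case_prod_beta, blast+)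
  qed
  obtain T where T: "finite T" "{0..2 * pi} \<subseteq> (\<Union>\<theta>\<^sub>0\<in>T. ball \<theta>\<^sub>0 (e \<theta>\<^sub>0))"
  proof (rule compactE_image)
    show "{0..2 * pi} \<subseteq> (\<Union>\<theta>\<^sub>0\<in>UNIV. ball \<theta>\<^sub>0 (e \<theta>\<^sub>0))"
      using eC(1) by (auto intro: centre_in_ball[THEN iffD2])
  qed auto
  define d where "d = Min (insert 1 (e ` T))"
  have d: "0 < d" "d \<le> 1" "\<And>\<theta>\<^sub>0. \<theta>\<^sub>0 \<in> T \<Longrightarrow> d \<le> e \<theta>\<^sub>0"
    using T(1) eC(1) by (auto simp: d_def)
  have C: "C \<theta>\<^sub>0 \<le> (\<Sum>\<theta>\<^sub>0\<in>T. C \<theta>\<^sub>0)" if "\<theta>\<^sub>0 \<in> T" for \<theta>\<^sub>0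
    using T(1) that eC(2) by (intro member_le_sum) auto
  show ?thesis
  proof (rule that[OF T(1) d(1,2)])
    show "0 \<le> (\<Sum>\<theta>\<^sub>0\<in>T. C \<theta>\<^sub>0)" using eC(2) by (simp add: sum_nonneg)
    fix r \<theta> assume r: "\<bar>r - 1\<bar> < d" and \<theta>: "\<theta> \<in> {0..2 * pi}" and ne: "(polar r \<theta> \<in> U) \<noteq> (polar 1 \<theta> \<in> U)"
    from \<theta> T obtain \<theta>\<^sub>0 where \<theta>\<^sub>0: "\<theta>\<^sub>0 \<in> T" "\<bar>\<theta> - \<theta>\<^sub>0\<bar> < e \<theta>\<^sub>0"
      by (auto simp: dist_real_def abs_minus_commute)
    have "\<bar>\<theta> - \<theta>\<^sub>0\<bar> \<le> C \<theta>\<^sub>0 * \<bar>r - 1\<bar> powr \<beta>"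
      using r d(3)[OF \<theta>\<^sub>0(1)] \<theta>\<^sub>0(2) ne by (intro eC(3)) auto
    also have "\<dots> \<le> (\<Sum>\<theta>\<^sub>0\<in>T. C \<theta>\<^sub>0) * \<bar>r - 1\<bar> powr \<beta>"
      using C[OF \<theta>\<^sub>0(1)] by (intro mult_right_mono) auto
    finally show "\<exists>\<theta>\<^sub>0\<in>T. \<bar>\<theta> - \<theta>\<^sub>0\<bar> \<le> (\<Sum>\<theta>\<^sub>0\<in>T. C \<theta>\<^sub>0) * \<bar>r - 1\<bar> powr \<beta>"
      using \<theta>\<^sub>0(1) by blast
  qed
qed

section \<open>Integrability of the singular weight on a sector\<close>

definition polar_box :: "real \<Rightarrow> real \<Rightarrow> real \<Rightarrow> (real^2) set" where
  "polar_box \<theta>\<^sub>0 \<rho> h = (\<lambda>v. polar (v $ 1) (v $ 2)) `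
    (cbox (vector [1 - \<rho>, \<theta>\<^sub>0 - h]) (vector [1 + \<rho>, \<theta>\<^sub>0 + h]) :: (real^2) set)"

lemma polar_in_polar_box:
  "\<bar>r - 1\<bar> \<le> \<rho> \<Longrightarrow> \<bar>\<theta> - \<theta>\<^sub>0\<bar> \<le> h \<Longrightarrow> polar r \<theta> \<in> polar_box \<theta>\<^sub>0 \<rho> h"
  unfolding polar_box_def
  by (rule image_eqI[of _ _ "vector [r, \<theta>]"]) (auto simp: mem_box_cart forall_2)

lemma compact_polar_box: "compact (polar_box \<theta>\<^sub>0 \<rho> h)"
  unfolding polar_box_def
  by (intro compact_continuous_image continuous_intros compact_cbox)

lemma has_derivative_polar:
  fixes v :: "real^2"
  shows "((\<lambda>v. polar (v $ 1) (v $ 2)) has_derivative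
    (\<lambda>w. vector [cos (v $ 2) * w $ 1 - v $ 1 * sin (v $ 2) * w $ 2, sin (v $ 2) * w $ 1 + v $ 1 * cos (v $ 2) * w $ 2]))
    (at v within S)"
proof -
  have comp: "((\<lambda>v. v $ k) has_derivative (\<lambda>w. w $ k)) (at v within S)" for k :: 2
    by (rule bounded_linear_imp_has_derivative) (rule bounded_linear_vec_nth)
  have 1: "((\<lambda>v. v $ 1 * cos (v $ 2)) has_derivative
      (\<lambda>w. cos (v $ 2) * w $ 1 - v $ 1 * sin (v $ 2) * w $ 2)) (at v within S)"
    by (auto intro!: derivative_eq_intros comp simp: fun_eq_iff algebra_simps)
  have 2: "((\<lambda>v. v $ 1 * sin (v $ 2)) has_derivative
      (\<lambda>w. sin (v $ 2) * w $ 1 + v $ 1 * cos (v $ 2) * w $ 2)) (at v within S)"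
    by (auto intro!: derivative_eq_intros comp simp: fun_eq_iff algebra_simps)
  have "((\<lambda>v. polar (v $ 1) (v $ 2) \<bullet> i) has_derivative
     (\<lambda>w. vector [cos (v $ 2) * w $ 1 - v $ 1 * sin (v $ 2) * w $ 2, sin (v $ 2) * w $ 1 + v $ 1 * cos (v $ 2) * w $ 2] \<bullet> i)) (at v within S)"
    if "i \<in> Basis" for i
  proof -
    from that obtain k where i: "i = axis k 1" by (auto simp: Basis_vec_def)
    consider "k = 1" | "k = 2" using exhaust_2 by blast
    then show ?thesis
      by cases (simp_all only: i inner_axis' mult_1 real_inner_1_left inner_real_def inner_axis mult_1_right
          polar_components vector_2 1 2)
  qed
  then show ?thesis
    by (subst has_derivative_componentwise_within) blast
qed

text \<open>
The Jacobian of polar coordinates is \<open>r \<le> 2\<close>, and the box of coordinates has area \<open>4 \<rho> h\<close>.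
\<close>

lemma measure_polar_box_le:
  assumes "0 \<le> \<rho>" "\<rho> \<le> 1" "0 \<le> h"
  shows "measure lborel (polar_box \<theta>\<^sub>0 \<rho> h) \<le> 8 * \<rho> * h"
proof -
  let ?S = "cbox (vector [1 - \<rho>, \<theta>\<^sub>0 - h]) (vector [1 + \<rho>, \<theta>\<^sub>0 + h]) :: (real^2) set"
  let ?D = "\<lambda>v w::real^2. vector [cos (v $ 2) * w $ 1 - v $ 1 * sin (v $ 2) * w $ 2,
    sin (v $ 2) * w $ 1 + v $ 1 * cos (v $ 2) * w $ 2] :: real^2"
  have det: "det (matrix (?D v)) = v $ 1" for v :: "real^2"
  proof -
    have "det (matrix (?D v)) = v $ 1 * (cos (v $ 2) * cos (v $ 2)) + v $ 1 * (sin (v $ 2) * sin (v $ 2))"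
      unfolding det_2 matrix_def by (simp add: axis_def mult_ac)
    also have "\<dots> = v $ 1 * ((sin (v $ 2))\<^sup>2 + (cos (v $ 2))\<^sup>2)"
      by (simp only: power2_eq_square distrib_left add.commute)
    finally show ?thesis by simp
  qed
  have int: "(\<lambda>v. \<bar>det (matrix (?D v))\<bar>) integrable_on ?S"
    unfolding det by (intro integrable_continuous continuous_intros)
  have bd: "\<bar>det (matrix (?D v))\<bar> \<le> 2" if "v \<in> ?S" for v
    using that assms unfolding det by (auto simp: mem_box_cart forall_2)
  have "?S \<in> lmeasurable" by simp
  from measure_bounded_differentiable_image[OF this has_derivative_polar int bd]
  have "measure lebesgue (polar_box \<theta>\<^sub>0 \<rho> h) \<le> 2 * measure lebesgue ?S"
    unfolding polar_box_def .
  also have "measure lebesgue ?S = (2 * \<rho>) * (2 * h)"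
    using assms by (subst measure_completion) (auto simp: content_cbox_cart UNIV_2 interval_ne_empty_cart forall_2)
  finally show ?thesis
    using compact_polar_box[THEN compact_imp_closed, of \<theta>\<^sub>0 \<rho> h] by (simp add: measure_completion)
qed

text \<open>
An integrable majorant for \<open>\<bar>1 - |x|\<bar> powr (-3/2)\<close> on a sector \<open>\<bar>\<theta> - \<theta>\<^sub>0\<bar> \<le> C \<bar>r - 1\<bar> powr (1/2 + \<alpha>)\<close>.
With \<open>\<rho>\<^sub>k = e / 2\<^sup>k\<close> the part of the sector with \<open>\<bar>r - 1\<bar> \<le> \<rho>\<^sub>k\<close> is contained in a polar box of area
at most \<open>8 C \<rho>\<^sub>k powr (3/2 + \<alpha>)\<close>. A point of the sector with \<open>\<rho>\<^sub>k\<^sub>+\<^sub>1 < \<bar>r - 1\<bar> \<le> \<rho>\<^sub>k\<close> has weight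
at most \<open>\<rho>\<^sub>k\<^sub>+\<^sub>1 powr (-3/2)\<close>, and the sum over the boxes is geometric with ratio \<open>2 powr (-\<alpha>)\<close>.
A majorant is given instead of an integral over the sector so that finitely many sectors can simply
be added.
\<close>

lemma holder_sector_majorant:
  fixes \<alpha> C e \<theta>\<^sub>0 :: real
  assumes \<alpha>: "\<alpha> > 0" and C: "C \<ge> 0" and e: "0 < e" "e \<le> 1"
  obtains G :: "real^2 \<Rightarrow> ennreal" where
    "G \<in> borel_measurable borel" "(\<integral>\<^sup>+x. G x \<partial>lborel) < \<infinity>"
    "\<And>r \<theta>. \<bar>r - 1\<bar> < e \<Longrightarrow> r \<noteq> 1 \<Longrightarrow> \<bar>\<theta> - \<theta>\<^sub>0\<bar> \<le> C * \<bar>r - 1\<bar> powr (1/2 + \<alpha>) \<Longrightarrow>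
      ennreal (1 / \<bar>1 - r\<bar> powr (3/2)) \<le> G (polar r \<theta>)"
proof -
  define \<rho> where "\<rho> k = e / 2 ^ k" for k :: nat
  define W where "W k = polar_box \<theta>\<^sub>0 (\<rho> k) (C * \<rho> k powr (1/2 + \<alpha>))" for k
  define G where "G x = (\<Sum>k. ennreal (1 / \<rho> (Suc k) powr (3/2)) * indicator (W k) x)" for x
  have \<rho>: "0 < \<rho> k" "\<rho> k \<le> 1" "\<rho> (Suc k) = \<rho> k / 2" for k
    using e by (auto simp: \<rho>_def field_simps intro: order_trans[OF _ one_le_power])
  have closed: "closed (W k)" for k
    unfolding W_def by (intro compact_imp_closed compact_polar_box)
  then have [measurable]: "W k \<in> sets borel" for k
    by simp
  have [measurable]: "G \<in> borel_measurable borel"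
    unfolding G_def by measurable
  have "(\<integral>\<^sup>+x. G x \<partial>lborel) = (\<Sum>k. ennreal (1 / \<rho> (Suc k) powr (3/2)) * emeasure lborel (W k))"
    unfolding G_def by (subst nn_integral_suminf) (auto simp: nn_integral_cmult_indicator)
  also have "\<dots> \<le> (\<Sum>k. ennreal (8 * C * 2 powr (3/2) * e powr \<alpha> * ((1/2) powr \<alpha>) ^ k))"
  proof (rule suminf_le)
    fix k
    have "emeasure lborel (W k) = ennreal (measure lborel (W k))"
      using emeasure_bounded_finite[OF compact_imp_bounded[OF compact_polar_box]]
      unfolding W_def by (intro emeasure_eq_ennreal_measure) (auto simp: less_top)
    also have "\<dots> \<le> ennreal (8 * \<rho> k * (C * \<rho> k powr (1/2 + \<alpha>)))"
      unfolding W_def using \<rho>[of k] C by (intro ennreal_leI measure_polar_box_le) auto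
    finally have "ennreal (1 / \<rho> (Suc k) powr (3/2)) * emeasure lborel (W k) \<le>
        ennreal (1 / \<rho> (Suc k) powr (3/2)) * ennreal (8 * \<rho> k * (C * \<rho> k powr (1/2 + \<alpha>)))"
      by (rule mult_left_mono) simp
    also have "\<dots> = ennreal (1 / \<rho> (Suc k) powr (3/2) * (8 * \<rho> k * (C * \<rho> k powr (1/2 + \<alpha>))))"
      using \<rho>[of k] C by (subst ennreal_mult) auto
    also have "1 / \<rho> (Suc k) powr (3/2) * (8 * \<rho> k * (C * \<rho> k powr (1/2 + \<alpha>))) =
        8 * C * 2 powr (3/2) * e powr \<alpha> * ((1/2) powr \<alpha>) ^ k"
    proof -
      have "\<rho> (Suc k) powr (3/2) = \<rho> k powr (3/2) / 2 powr (3/2)"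
        unfolding \<rho>(3)[of k] using \<rho>(1)[of k] by (simp add: powr_divide)
      moreover have "\<rho> k * \<rho> k powr (1/2 + \<alpha>) = \<rho> k powr (3/2) * \<rho> k powr \<alpha>"
      proof -
        have "\<rho> k * \<rho> k powr (1/2 + \<alpha>) = \<rho> k powr 1 * \<rho> k powr (1/2 + \<alpha>)"
          using \<rho>(1)[of k] by simp
        also have "\<dots> = \<rho> k powr (3/2) * \<rho> k powr \<alpha>"
          unfolding powr_add[symmetric] by (simp add: algebra_simps)
        finally show ?thesis .
      qed
      moreover have "\<rho> k powr \<alpha> = e powr \<alpha> * ((1/2) powr \<alpha>) ^ k"
      proof -
        have "\<rho> k = e * (1/2) ^ k" by (simp add: \<rho>_def power_one_over)
        moreover have "((1/2::real) ^ k) powr \<alpha> = ((1/2) powr \<alpha>) ^ k"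
        proof (induction k)
          case (Suc k)
          then show ?case
            unfolding power_Suc by (subst powr_mult) auto
        qed simp
        ultimately show ?thesis using e by (simp add: powr_mult)
      qed
      moreover have "\<rho> k powr (3/2) > 0" using \<rho>(1)[of k] by simp
      ultimately show ?thesis by (simp add: mult.left_commute[of "\<rho> k"] mult_ac)
    qed
    finally show "ennreal (1 / \<rho> (Suc k) powr (3/2)) * emeasure lborel (W k) \<le>
        ennreal (8 * C * 2 powr (3/2) * e powr \<alpha> * ((1/2) powr \<alpha>) ^ k)" .
  qed auto
  also have "\<dots> < \<infinity>"
  proof -
    have "(1/2 :: real) powr \<alpha> < 1"
      using \<alpha> powr_less_mono2[of \<alpha> "1/2" 1] by simp
    then have "summable (\<lambda>k. 8 * C * 2 powr (3/2) * e powr \<alpha> * ((1/2) powr \<alpha>) ^ k)"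
      by (intro summable_mult summable_geometric) simp
    then show ?thesis
      using C by (subst suminf_ennreal2) auto
  qed
  finally have fin: "(\<integral>\<^sup>+x. G x \<partial>lborel) < \<infinity>" .
  have term_le_suminf: "f k \<le> suminf f" for f :: "nat \<Rightarrow> ennreal" and k
    using sum_le_suminf[of f "{k}"] by (simp add: summableI)
  have "ennreal (1 / \<bar>1 - r\<bar> powr (3/2)) \<le> G (polar r \<theta>)"
    if r: "\<bar>r - 1\<bar> < e" "r \<noteq> 1" and \<theta>: "\<bar>\<theta> - \<theta>\<^sub>0\<bar> \<le> C * \<bar>r - 1\<bar> powr (1/2 + \<alpha>)" for r \<theta>
  proof -
    have "\<exists>n. \<rho> n < \<bar>r - 1\<bar>"
    proof -
      obtain n where "(1/2::real) ^ n < \<bar>r - 1\<bar> / e"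
        using real_arch_pow_inv[of "\<bar>r - 1\<bar> / e" "1/2"] r e by auto
      then show ?thesis using e by (auto simp: \<rho>_def power_one_over field_simps)
    qed
    moreover have "\<not> \<rho> 0 < \<bar>r - 1\<bar>" using r by (simp add: \<rho>_def)
    ultimately obtain k where k: "\<bar>r - 1\<bar> \<le> \<rho> k" "\<rho> (Suc k) < \<bar>r - 1\<bar>"
      using exists_least_lemma[of "\<lambda>n. \<rho> n < \<bar>r - 1\<bar>"] by (auto simp: not_less)
    have "polar r \<theta> \<in> W k"
      unfolding W_def
    proof (rule polar_in_polar_box)
      note \<theta>
      also have "C * \<bar>r - 1\<bar> powr (1/2 + \<alpha>) \<le> C * \<rho> k powr (1/2 + \<alpha>)"
        using C k \<alpha> by (intro mult_left_mono powr_mono2) auto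
      finally show "\<bar>\<theta> - \<theta>\<^sub>0\<bar> \<le> C * \<rho> k powr (1/2 + \<alpha>)" .
    qed (rule k)
    have "1 / \<bar>1 - r\<bar> powr (3/2) \<le> 1 / \<rho> (Suc k) powr (3/2)"
      using k \<rho>(1)[of "Suc k"] by (intro divide_left_mono powr_mono2 mult_pos_pos) auto
    then have "ennreal (1 / \<bar>1 - r\<bar> powr (3/2)) \<le> ennreal (1 / \<rho> (Suc k) powr (3/2)) * indicator (W k) (polar r \<theta>)"
      using \<open>polar r \<theta> \<in> W k\<close> by (simp add: ennreal_leI)
    also have "\<dots> \<le> G (polar r \<theta>)"
      unfolding G_def by (rule term_le_suminf[where f = "\<lambda>k. ennreal (1 / \<rho> (Suc k) powr (3/2)) * indicator (W k) (polar r \<theta>)"])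
    finally show ?thesis .
  qed
  with fin show ?thesis by (intro that[of G]) auto
qed

section \<open>Comparison with the cone\<close>

text \<open>
For \<open>U\<close> in the plane this is the cone over \<open>U \<inter> S\<^sup>1\<close>, without its apex. It has the same trace on
the circle as \<open>U\<close>.
\<close>

definition radial_hull :: "'a::real_normed_vector set \<Rightarrow> 'a set" where
  "radial_hull U = {x. x \<noteq> 0 \<and> sgn x \<in> U}"

lemma scaleR_in_radial_hull: "0 < t \<Longrightarrow> x \<in> radial_hull U \<Longrightarrow> t *\<^sub>R x \<in> radial_hull U"
  by (simp add: radial_hull_def sgn_scaleR)

lemma open_radial_hull:
  assumes "open U"
  shows "open (radial_hull U)"
proof -
  have "open ((- {0}) \<inter> sgn -` U)"
    using assms by (intro continuous_open_preimage continuous_on_sgn continuous_on_id) auto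
  also have "(- {0}) \<inter> sgn -` U = radial_hull U"
    by (auto simp: radial_hull_def)
  finally show ?thesis .
qed

text \<open>
Near the circle the symmetric difference is covered by finitely many sectors, whose majorants are
added. Elsewhere the weight is at most a multiple of \<open>(1 + |x|) powr (-3)\<close>. The denominator
\<open>\<bar>1 - |x|\<bar> (1 + |x|)\<close> is \<open>\<bar>1 - |x|\<^sup>2\<bar>\<close>.
\<close>

lemma integrable_symmetric_difference_weight:
  fixes U :: "(real^2) set"
  assumes U: "open U" "transversal (1/2 + \<alpha>) U" and \<alpha>: "\<alpha> > 0"
  shows "integrable lborel (\<lambda>x. \<bar>indicator U x - indicator (radial_hull U) x\<bar> *
      (1 / (\<bar>1 - norm x\<bar> * (1 + norm x)) powr (3/2)))"
    (is "integrable _ ?w")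
proof (rule integrableI_nonneg)
  have [measurable]: "U \<in> sets borel" "radial_hull U \<in> sets borel"
    using borel_open[OF U(1)] borel_open[OF open_radial_hull[OF U(1)]] by simp_all
  show "?w \<in> borel_measurable lborel" by measurable
  show "AE x in lborel. 0 \<le> ?w x"
    by (intro AE_I2 mult_nonneg_nonneg divide_nonneg_nonneg abs_ge_zero powr_ge_zero zero_le_one)
  have \<beta>: "0 < 1/2 + \<alpha>" using \<alpha> by simp
  obtain T e C where T: "finite T" "0 < e" "e \<le> 1" "0 \<le> C"
    and sectors: "\<And>r \<theta>. \<bar>r - 1\<bar> < e \<Longrightarrow> \<theta> \<in> {0..2 * pi} \<Longrightarrow> (polar r \<theta> \<in> U) \<noteq> (polar 1 \<theta> \<in> U) \<Longrightarrow>
      \<exists>\<theta>\<^sub>0\<in>T. \<bar>\<theta> - \<theta>\<^sub>0\<bar> \<le> C * \<bar>r - 1\<bar> powr (1/2 + \<alpha>)"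
    by (rule transversal_uniform[OF U(2) \<beta>]) (rule that)
  define majorant :: "real \<Rightarrow> (real^2 \<Rightarrow> ennreal) \<Rightarrow> bool" where
    "majorant \<theta>\<^sub>0 G \<longleftrightarrow> G \<in> borel_measurable borel \<and> (\<integral>\<^sup>+x. G x \<partial>lborel) < \<infinity> \<and>
      (\<forall>r \<theta>. \<bar>r - 1\<bar> < e \<longrightarrow> r \<noteq> 1 \<longrightarrow> \<bar>\<theta> - \<theta>\<^sub>0\<bar> \<le> C * \<bar>r - 1\<bar> powr (1/2 + \<alpha>) \<longrightarrow>
        ennreal (1 / \<bar>1 - r\<bar> powr (3/2)) \<le> G (polar r \<theta>))" for \<theta>\<^sub>0 G
  have "\<forall>\<theta>\<^sub>0. \<exists>G. majorant \<theta>\<^sub>0 G"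
  proof
    show "\<exists>G. majorant \<theta>\<^sub>0 G" for \<theta>\<^sub>0
      unfolding majorant_def by (rule holder_sector_majorant[OF \<alpha> T(4,2,3), of \<theta>\<^sub>0]) blast
  qed
  then obtain G where "\<forall>\<theta>\<^sub>0. majorant \<theta>\<^sub>0 (G \<theta>\<^sub>0)"
    by (rule choice[THEN exE])
  then have G [measurable]: "G \<theta>\<^sub>0 \<in> borel_measurable borel"
    and G_fin: "(\<integral>\<^sup>+x. G \<theta>\<^sub>0 x \<partial>lborel) < \<infinity>"
    and G_ge: "\<bar>r - 1\<bar> < e \<Longrightarrow> r \<noteq> 1 \<Longrightarrow> \<bar>\<theta> - \<theta>\<^sub>0\<bar> \<le> C * \<bar>r - 1\<bar> powr (1/2 + \<alpha>) \<Longrightarrow>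
        ennreal (1 / \<bar>1 - r\<bar> powr (3/2)) \<le> G \<theta>\<^sub>0 (polar r \<theta>)" for \<theta>\<^sub>0 r \<theta>
    unfolding majorant_def by blast+
  define K where "K = (1 + 2 / e) powr (3/2)"
  have "ennreal (?w x) \<le> (\<Sum>\<theta>\<^sub>0\<in>T. G \<theta>\<^sub>0 x) + ennreal (K * (1 / (1 + norm x) ^ 3))" for x
  proof (cases "(x \<in> U) = (x \<in> radial_hull U)")
    case True
    then have "indicator U x - indicator (radial_hull U) x = (0 :: real)"
      by (simp add: indicator_def)
    then have "?w x = 0" by (simp only: abs_zero mult_zero_left)
    then show ?thesis by (simp only: ennreal_0 zero_le)
  next
    case False
    define r where "r = norm x"
    have r0: "r \<ge> 0" by (simp add: r_def)
    have w: "?w x = 1 / (\<bar>1 - r\<bar> * (1 + r)) powr (3/2)"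
    proof -
      from False have "\<bar>indicator U x - indicator (radial_hull U) x\<bar> = (1 :: real)"
        by (auto simp: indicator_def)
      then show ?thesis by (simp only: mult_1_left r_def)
    qed
    show ?thesis
    proof (cases "\<bar>r - 1\<bar> < e")
      case near: True
      then have r: "r > 0" using T(3) by linarith
      obtain \<theta> where \<theta>: "\<theta> \<in> {0..2 * pi}" "x = polar r \<theta>"
        unfolding r_def by (rule exists_polar_angle)
      from r have hull: "x \<in> radial_hull U \<longleftrightarrow> polar 1 \<theta> \<in> U"
        unfolding radial_hull_def mem_Collect_eq \<theta>(2) sgn_polar[OF r]
        using norm_polar[of r \<theta>] by fastforce
      with False \<theta>(2) have ne: "(polar r \<theta> \<in> U) \<noteq> (polar 1 \<theta> \<in> U)" by simp
      \<comment> \<open>The two sets agree on the circle, where the weight would be singular.\<close>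
      then have r1: "r \<noteq> 1" by auto
      obtain \<theta>\<^sub>0 where \<theta>\<^sub>0: "\<theta>\<^sub>0 \<in> T" "\<bar>\<theta> - \<theta>\<^sub>0\<bar> \<le> C * \<bar>r - 1\<bar> powr (1/2 + \<alpha>)"
        using sectors[OF near \<theta>(1) ne] by blast
      have "\<bar>1 - r\<bar> \<le> \<bar>1 - r\<bar> * (1 + r)"
        using mult_left_mono[of 1 "1 + r" "\<bar>1 - r\<bar>"] r0 by simp
      then have "\<bar>1 - r\<bar> powr (3/2) \<le> (\<bar>1 - r\<bar> * (1 + r)) powr (3/2)"
        by (intro powr_mono2) auto
      moreover have "0 < \<bar>1 - r\<bar> powr (3/2)"
        using r1 by simp
      ultimately have "?w x \<le> 1 / \<bar>1 - r\<bar> powr (3/2)"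
        unfolding w by (rule frac_le[OF zero_le_one order_refl, rotated])
      then have "ennreal (?w x) \<le> ennreal (1 / \<bar>1 - r\<bar> powr (3/2))"
        by (rule ennreal_leI)
      also have "\<dots> \<le> G \<theta>\<^sub>0 x"
        unfolding \<theta>(2) by (rule G_ge[OF near r1 \<theta>\<^sub>0(2)])
      also have "\<dots> \<le> (\<Sum>\<theta>\<^sub>0\<in>T. G \<theta>\<^sub>0 x)"
        using T(1) \<theta>\<^sub>0(1) by (intro member_le_sum) auto
      also have "\<dots> \<le> (\<Sum>\<theta>\<^sub>0\<in>T. G \<theta>\<^sub>0 x) + ennreal (K * (1 / (1 + norm x) ^ 3))"
        by (rule add_increasing2) auto
      finally show ?thesis .
    next
      case far: False
      have "?w x \<le> K * (1 / (1 + r) ^ 3)"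
        unfolding w K_def using far r0 T(2) by (intro inverse_powr_decay) auto
      then have "ennreal (?w x) \<le> ennreal (K * (1 / (1 + norm x) ^ 3))"
        unfolding r_def by (rule ennreal_leI)
      also have "\<dots> \<le> (\<Sum>\<theta>\<^sub>0\<in>T. G \<theta>\<^sub>0 x) + ennreal (K * (1 / (1 + norm x) ^ 3))"
        by (rule add_increasing) auto
      finally show ?thesis .
    qed
  qed
  then have "(\<integral>\<^sup>+x. ennreal (?w x) \<partial>lborel) \<le>
      (\<integral>\<^sup>+x. ((\<Sum>\<theta>\<^sub>0\<in>T. G \<theta>\<^sub>0 x) + ennreal (K * (1 / (1 + norm x) ^ 3))) \<partial>lborel)"
    by (rule nn_integral_mono)
  also have "\<dots> = (\<Sum>\<theta>\<^sub>0\<in>T. \<integral>\<^sup>+x. G \<theta>\<^sub>0 x \<partial>lborel) + (\<integral>\<^sup>+x. ennreal (K * (1 / (1 + norm (x :: real^2)) ^ 3)) \<partial>lborel)"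
    by (subst nn_integral_add) (auto simp: nn_integral_sum)
  also have "\<dots> < \<infinity>"
  proof -
    have "integrable lborel (\<lambda>x::real^2. K * (1 / (1 + norm x) ^ 3))"
      by (intro integrable_mult_right integrable_norm_inverse_cube)
    then have "(\<integral>\<^sup>+x. ennreal (K * (1 / (1 + norm (x :: real^2)) ^ 3)) \<partial>lborel) < \<infinity>"
      by (subst nn_integral_eq_integral) (auto simp: K_def)
    moreover have "(\<Sum>\<theta>\<^sub>0\<in>T. \<integral>\<^sup>+x. G \<theta>\<^sub>0 x \<partial>lborel) < \<infinity>"
      using T(1) G_fin by (simp add: less_top)
    ultimately show ?thesis by (simp add: less_top)
  qed
  finally show "(\<integral>\<^sup>+x. ennreal (?w x) \<partial>lborel) < \<infinity>" .
qed

theorem theorem3p1: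
  fixes \<alpha> :: real and U :: "(real^2) set"
  assumes "\<alpha> > 0"
    and "open U" and "connected U"
    and "transversal (1/2 + \<alpha>) U"
  shows "\<exists>m. has_area U m"
proof -
  define Z where "Z = radial_hull U"
  define s :: "real^2 \<Rightarrow> real" where "s x = indicator U x - indicator Z x" for x
  define w where "w x = \<bar>s x\<bar> * (1 / (\<bar>1 - norm x\<bar> * (1 + norm x)) powr (3/2))" for x
  \<comment> \<open>On the circle the factor \<open>s\<close> vanishes, so the second branch stands for the exterior.\<close>
  define L :: "real^2 \<Rightarrow> complex" where "L x = (if norm x < 1 then complex_of_real (1 / (1 - (norm x)\<^sup>2) powr (3/2))
      else \<i> ^ 3 * complex_of_real (1 / ((norm x)\<^sup>2 - 1) powr (3/2)))" for x
  have Z: "Z \<in> sets borel" unfolding Z_def using open_radial_hull[OF assms(2)] by simp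
  have [measurable]: "U \<in> sets borel" "Z \<in> sets borel" using assms(2) Z by auto
  have [measurable]: "s \<in> borel_measurable borel" unfolding s_def by measurable
  have [measurable]: "L \<in> borel_measurable borel" unfolding L_def by measurable
  have dV_meas: "dV \<epsilon> \<in> borel_measurable borel" if "\<epsilon> > 0" for \<epsilon>
  proof -
    have "(\<lambda>x::real^2. radial_density \<epsilon> (norm x)) \<in> borel_measurable borel"
      by (rule measurable_compose[OF borel_measurable_norm borel_measurable_radial_density[OF that]])
    then show ?thesis by (simp add: dV_eq_radial_density[abs_def])
  qed
  have w_int: "integrable lborel w"
    unfolding w_def s_def Z_def by (rule integrable_symmetric_difference_weight[OF assms(2,4,1)])
  have s_circle: "s x = 0" if "norm x = 1" for x
  proof -
    from that have "sgn x = x" "x \<noteq> 0" by (auto simp: sgn_div_norm)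
    then show ?thesis by (simp add: s_def Z_def radial_hull_def indicator_def)
  qed
  have dom: "norm (s x *\<^sub>R dV \<epsilon> x) \<le> (1 + \<epsilon>) * w x" if "\<epsilon> > 0" for \<epsilon> x
  proof (cases "norm x = 1")
    case False
    have "norm (dV \<epsilon> x) \<le> (1 + \<epsilon>) * (1 / (\<bar>1 - norm x\<bar> * (1 + norm x)) powr (3/2))"
      unfolding dV_eq_radial_density using False that
      by (intro norm_radial_density_le) (auto intro!: real_le_rsqrt)
    then have "\<bar>s x\<bar> * norm (dV \<epsilon> x) \<le> \<bar>s x\<bar> * ((1 + \<epsilon>) * (1 / (\<bar>1 - norm x\<bar> * (1 + norm x)) powr (3/2)))"
      by (intro mult_left_mono) auto
    then show ?thesis by (simp add: w_def mult_ac)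
  qed (simp add: s_circle w_def)
  have s_int: "integrable lborel (\<lambda>x. s x *\<^sub>R dV \<epsilon> x)" if "\<epsilon> > 0" for \<epsilon>
  proof (rule Bochner_Integration.integrable_bound)
    show "integrable lborel (\<lambda>x. (1 + \<epsilon>) * w x)" using w_int by simp
    show "(\<lambda>x. s x *\<^sub>R dV \<epsilon> x) \<in> borel_measurable lborel"
      using dV_meas[OF that] by simp
    show "AE x in lborel. norm (s x *\<^sub>R dV \<epsilon> x) \<le> norm ((1 + \<epsilon>) * w x)"
      unfolding real_norm_def by (intro AE_I2 order_trans[OF dom[OF that] abs_ge_self])
  qed
  have Z_cone: "t *\<^sub>R x \<in> Z" if "0 < t" "x \<in> Z" for t x
    using that scaleR_in_radial_hull unfolding Z_def by blast
  have Z_int: "integrable lborel (\<lambda>x. indicator Z x *\<^sub>R dV \<epsilon> x)" if "\<epsilon> > 0" for \<epsilon>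
    using set_integrable_dV_cone[OF that Z Z_cone] unfolding set_integrable_def .
  have split: "indicator U x *\<^sub>R dV \<epsilon> x = indicator Z x *\<^sub>R dV \<epsilon> x + s x *\<^sub>R dV \<epsilon> x" for x \<epsilon>
    by (simp add: s_def scaleR_diff_left)
  have U_int: "set_integrable lborel U (dV \<epsilon>)" if "\<epsilon> > 0" for \<epsilon>
    unfolding set_integrable_def split using Z_int[OF that] s_int[OF that] by simp
  have U_eq: "(LINT x:U|lborel. dV \<epsilon> x) = - of_real (2 * measure lborel (Z \<inter> cball 0 1)) + (LINT x|lborel. s x *\<^sub>R dV \<epsilon> x)"
    if "\<epsilon> > 0" for \<epsilon>
  proof -
    have "(LINT x:U|lborel. dV \<epsilon> x) = (LINT x:Z|lborel. dV \<epsilon> x) + (LINT x|lborel. s x *\<^sub>R dV \<epsilon> x)"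
      unfolding set_lebesgue_integral_def split using Z_int[OF that] s_int[OF that] by simp
    also have "(LINT x:Z|lborel. dV \<epsilon> x) = - of_real (2 * measure lborel (Z \<inter> cball 0 1))"
      by (rule set_integral_dV_cone[OF that Z Z_cone])
    finally show ?thesis .
  qed
  have L: "((\<lambda>\<epsilon>. s x *\<^sub>R dV \<epsilon> x) \<longlongrightarrow> s x *\<^sub>R L x) (at_right 0)" for x
  proof (cases "norm x = 1")
    case False
    then have "((\<lambda>\<epsilon>. dV \<epsilon> x) \<longlongrightarrow> L x) (at_right 0)"
    proof (cases "norm x < 1")
      case True
      then show ?thesis
        unfolding L_def if_P[OF True] by (rule dV_tendsto_H)
    next
      case F: False
      with False show ?thesis
        unfolding L_def if_not_P[OF F] by (intro dV_tendsto_L) simp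
    qed
    then show ?thesis by (intro tendsto_intros)
  qed (simp add: s_circle)
  have "((\<lambda>\<epsilon>. LINT x|lborel. s x *\<^sub>R dV \<epsilon> x) \<longlongrightarrow> (LINT x|lborel. s x *\<^sub>R L x)) (at_right 0)"
  proof (rule tendsto_at_right_sequentially)
    show "(0::real) < 1" by simp
    fix E :: "nat \<Rightarrow> real"
    assume E: "\<And>n. 0 < E n" "\<And>n. E n < 1" and lim: "E \<longlonglongrightarrow> 0"
    from E lim have E_right: "filterlim E (at_right 0) sequentially"
      unfolding filterlim_at by (simp add: less_imp_neq[symmetric])
    show "(\<lambda>n. LINT x|lborel. s x *\<^sub>R dV (E n) x) \<longlonglongrightarrow> (LINT x|lborel. s x *\<^sub>R L x)"
    proof (rule integral_dominated_convergence)
      show "integrable lborel (\<lambda>x. 2 * w x)" using w_int by simp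
      show "AE x in lborel. (\<lambda>n. s x *\<^sub>R dV (E n) x) \<longlonglongrightarrow> s x *\<^sub>R L x"
        using filterlim_compose[OF L E_right] by simp
      show "AE x in lborel. norm (s x *\<^sub>R dV (E n) x) \<le> 2 * w x" for n
      proof (rule AE_I2)
        fix x
        have "(1 + E n) * w x \<le> 2 * w x"
          using E(2)[of n] by (intro mult_right_mono) (auto simp: w_def)
        with dom[OF E(1)[of n], of x] show "norm (s x *\<^sub>R dV (E n) x) \<le> 2 * w x" by linarith
      qed
      show "(\<lambda>x. s x *\<^sub>R dV (E n) x) \<in> borel_measurable lborel" for n
        using dV_meas[OF E(1)] by simp
    qed simp
  qed
  from tendsto_add[OF tendsto_const this]
  have "((\<lambda>\<epsilon>. LINT x:U|lborel. dV \<epsilon> x) \<longlongrightarrow>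
      - of_real (2 * measure lborel (Z \<inter> cball 0 1)) + (LINT x|lborel. s x *\<^sub>R L x)) (at_right 0)"
  proof (rule Lim_transform_eventually)
    show "\<forall>\<^sub>F \<epsilon> in at_right 0. - of_real (2 * measure lborel (Z \<inter> cball 0 1)) + (LINT x|lborel. s x *\<^sub>R dV \<epsilon> x) =
        (LINT x:U|lborel. dV \<epsilon> x)"
      using eventually_at_right_less[of 0] by eventually_elim (rule U_eq[symmetric])
  qed
  with U_int show ?thesis
    unfolding has_area_def by blast
qed

end
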